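(* Let $\mathbb{F}$ be a field of characteristic $3$. For every integer $n\ge 1$, the simple modular Lie algebra $H(2;(1,n))^{(2)}$ over $\mathbb{F}$, which has dimension $3^{n+1}-2$, does not have a solvable outer derivation algebra; that is, $\mathrm{Out}\big(H(2;(1,n))^{(2)}\big)$ is not solvable.
   Context: For a finite-dimensional Lie algebra $\mathfrak{g}$ over a field $\mathbb{F}$, $\mathrm{Der}(\mathfrak{g})$ is the Lie algebra of $\mathbb{F}$-linear derivations of $\mathfrak{g}$, $\mathrm{ad}(\mathfrak{g})$ is its ideal of inner derivations, and $\mathrm{Out}(\mathfrak{g})=\mathrm{Der}(\mathfrak{g})/\mathrm{ad}(\mathfrak{g})$ is the outer derivation algebra. Hamiltonian algebras. Let $\mathbb{F}$ have characteristic $p>2$, let $m=2r$ with $r\ge 1$, and let $\underline{n}=(n_1,\ldots,n_m)$ be a tuple of positive integers with $|\underline{n}|=n_1+\cdots+n_m$. The divided power algebra $\mathcal{O}(m;\underline{n})$ is the commutative associative unital $\mathbb{F}$-algebra with basis $\{x^{(a)} : a=(a_1,\ldots,a_m),\ a_i\in\mathbb{Z},\ 0\le a_i<p^{n_i}\}$ and product $x^{(a)}x^{(b)}=\binom{a+b}{b}x^{(a+b)}$, where $\binom{a}{b}=\prod_{i=1}^m\binom{a_i}{b_i}$ and $x^{(c)}=0$ if $c_i\ge p^{n_i}$ for some $i$. Let $\varepsilon_i=(\delta_{i,1},\ldots,\delta_{i,m})$, and let $\partial_i$ be the derivation of $\mathcal{O}(m;\underline{n})$ with $\partial_i(x^{(a)})=x^{(a-\varepsilon_i)}$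 (which is $0$ if $a_i=0$). The generalized Jacobson-Witt algebra is $W(m;\underline{n})=\sum_{i=1}^m\mathcal{O}(m;\underline{n})\partial_i$, with the commutator bracket of derivations. Put $\sigma(i)=1$ and $i'=i+r$ for $1\le i\le r$, and $\sigma(i)=-1$ and $i'=i-r$ for $r+1\le i\le 2r$. Define the linear map $D_H\colon\mathcal{O}(2r;\underline{n})\to W(2r;\underline{n})$ by $D_H(x^{(a)})=\sum_{i=1}^{2r}\sigma(i)\,\partial_i(x^{(a)})\,\partial_{i'}$. Let $\tau(\underline{n})=(p^{n_1}-1,\ldots,p^{n_m}-1)$. The Hamiltonian algebra is $$H(2r;\underline{n})^{(2)}=\mathrm{span}\{D_H(x^{(a)}) : 0<a<\tau(\underline{n})\},$$ where $0<a<\tau(\underline{n})$ means $0\le a_i\le p^{n_i}-1$ for all $i$, with $a\ne 0$ and $a\neq\tau(\underline{n})$. It is a Lie subalgebra of $W(2r;\underline{n})$ of dimension $p^{|\underline{n}|}-2$, with bracket $[D_H(x^{(a)}),D_H(x^{(b)})]=D_H\big(D_H(x^{(a)})(x^{(b)})\big)$. The case needed here is $p=3$, $r=1$, $\underline{n}=(1,n)$. *)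

theory Defs
  imports "Jordan_Normal_Form.VS_Connect" "HOL-Algebra.QuotRing"
begin

section \<open>Lie algebras over a field\<close>

text \<open>The record extends the vector space record \<^type>\<open>module\<close> of HOL-Algebra. As for
  modules in general, the inherited fields \<open>mult\<close> and \<open>one\<close> play no role in the Lie
  algebra structure.\<close>

record ('a, 'b) lie_algebra = "('a, 'b) module" +
  bracket :: "'b \<Rightarrow> 'b \<Rightarrow> 'b"

locale lie_algebra = vectorspace K L
  for K :: "('a, 'c) ring_scheme" and L :: "('a, 'b, 'd) lie_algebra_scheme" (structure) +
  assumes bracket_closed:
      "\<lbrakk>x \<in> carrier L; y \<in> carrier L\<rbrakk> \<Longrightarrow> bracket L x y \<in> carrier L"
    and bracket_add_left:
      "\<lbrakk>x \<in> carrier L; y \<in> carrier L; z \<in> carrier L\<rbrakk> \<Longrightarrow>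
        bracket L (x \<oplus> y) z = bracket L x z \<oplus> bracket L y z"
    and bracket_add_right:
      "\<lbrakk>x \<in> carrier L; y \<in> carrier L; z \<in> carrier L\<rbrakk> \<Longrightarrow>
        bracket L x (y \<oplus> z) = bracket L x y \<oplus> bracket L x z"
    and bracket_smult_left:
      "\<lbrakk>c \<in> carrier K; x \<in> carrier L; y \<in> carrier L\<rbrakk> \<Longrightarrow>
        bracket L (c \<odot> x) y = c \<odot> bracket L x y"
    and bracket_smult_right:
      "\<lbrakk>c \<in> carrier K; x \<in> carrier L; y \<in> carrier L\<rbrakk> \<Longrightarrow>
        bracket L x (c \<odot> y) = c \<odot> bracket L x y"
    and bracket_self: "x \<in> carrier L \<Longrightarrow> bracket L x x = \<zero>"
    and jacobi:
      "\<lbrakk>x \<in> carrier L; y \<in> carrier L; z \<in> carrier L\<rbrakk> \<Longrightarrow>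
        bracket L x (bracket L y z) \<oplus> bracket L y (bracket L z x)
          \<oplus> bracket L z (bracket L x y) = \<zero>"

definition lie_ideal ::
    "('a, 'c) ring_scheme \<Rightarrow> ('a, 'b, 'd) lie_algebra_scheme \<Rightarrow> 'b set \<Rightarrow> bool" where
  "lie_ideal K L I \<longleftrightarrow>
     LinearCombinations.submodule K I L \<and> (\<forall>x\<in>carrier L. \<forall>y\<in>I. bracket L x y \<in> I)"

locale simple_lie_algebra = lie_algebra +
  assumes nonabelian: "\<exists>x\<in>carrier L. \<exists>y\<in>carrier L. bracket L x y \<noteq> \<zero>"
    and ideals_trivial: "lie_ideal K L I \<Longrightarrow> I = {\<zero>} \<or> I = carrier L"

fun derived_series ::
    "('a, 'c) ring_scheme \<Rightarrow> ('a, 'b, 'd) lie_algebra_scheme \<Rightarrow> nat \<Rightarrow> 'b set" where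
  "derived_series K L 0 = carrier L"
| "derived_series K L (Suc k) =
     LinearCombinations.module.span K L
       {bracket L x y | x y. x \<in> derived_series K L k \<and> y \<in> derived_series K L k}"

definition solvable_lie ::
    "('a, 'c) ring_scheme \<Rightarrow> ('a, 'b, 'd) lie_algebra_scheme \<Rightarrow> bool" where
  "solvable_lie K L \<longleftrightarrow> (\<exists>k. derived_series K L k = {\<zero>\<^bsub>L\<^esub>})"

text \<open>Operators on \<open>V\<close> are represented by functions on \<open>carrier V\<close> that are \<^const>\<open>undefined\<close>
  elsewhere, so that equality of operators is equality of functions. A set \<open>S\<close> of operators
  carries the pointwise vector space operations and the commutator as bracket.\<close>

definition operator_lie_algebra ::
    "('a, 'b, 'd) module_scheme \<Rightarrow> ('b \<Rightarrow> 'b) set \<Rightarrow> ('a, 'b \<Rightarrow> 'b) lie_algebra" where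
  "operator_lie_algebra V S =
     \<lparr>carrier = S,
      mult = compose (carrier V),
      one = restrict (\<lambda>x. x) (carrier V),
      zero = restrict (\<lambda>x. \<zero>\<^bsub>V\<^esub>) (carrier V),
      add = (\<lambda>D E. restrict (\<lambda>x. D x \<oplus>\<^bsub>V\<^esub> E x) (carrier V)),
      smult = (\<lambda>c D. restrict (\<lambda>x. c \<odot>\<^bsub>V\<^esub> D x) (carrier V)),
      bracket = (\<lambda>D E. restrict (\<lambda>x. D (E x) \<ominus>\<^bsub>V\<^esub> E (D x)) (carrier V))\<rparr>"

definition derivations ::
    "('a, 'c) ring_scheme \<Rightarrow> ('a, 'b, 'd) lie_algebra_scheme \<Rightarrow> ('b \<Rightarrow> 'b) set" where
  "derivations K L =
     {D \<in> LinearCombinations.module_hom K L L. D \<in> extensional (carrier L) \<and>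
        (\<forall>x\<in>carrier L. \<forall>y\<in>carrier L.
           D (bracket L x y) = bracket L (D x) y \<oplus>\<^bsub>L\<^esub> bracket L x (D y))}"

definition Der ::
    "('a, 'c) ring_scheme \<Rightarrow> ('a, 'b, 'd) lie_algebra_scheme \<Rightarrow> ('a, 'b \<Rightarrow> 'b) lie_algebra" where
  "Der K L = operator_lie_algebra L (derivations K L)"

definition inner_derivations :: "('a, 'b, 'd) lie_algebra_scheme \<Rightarrow> ('b \<Rightarrow> 'b) set" where
  "inner_derivations L = (\<lambda>x. restrict (bracket L x) (carrier L)) ` carrier L"

text \<open>Cosets, as for quotient rings in \<^theory>\<open>HOL-Algebra.QuotRing\<close>.\<close>

definition lie_quotient ::
    "('a, 'b, 'd) lie_algebra_scheme \<Rightarrow> 'b set \<Rightarrow> ('a, 'b set) lie_algebra" where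
  "lie_quotient L I =
     \<lparr>carrier = a_rcosets\<^bsub>L\<^esub> I,
      mult = rcoset_mult L I,
      one = I +>\<^bsub>L\<^esub> \<one>\<^bsub>L\<^esub>,
      zero = I,
      add = set_add L,
      smult = (\<lambda>c A. \<Union>x\<in>A. I +>\<^bsub>L\<^esub> (c \<odot>\<^bsub>L\<^esub> x)),
      bracket = (\<lambda>A B. \<Union>x\<in>A. \<Union>y\<in>B. I +>\<^bsub>L\<^esub> bracket L x y)\<rparr>"

definition Out ::
    "('a, 'c) ring_scheme \<Rightarrow> ('a, 'b, 'd) lie_algebra_scheme
      \<Rightarrow> ('a, ('b \<Rightarrow> 'b) set) lie_algebra" where
  "Out K L = lie_quotient (Der K L) (inner_derivations L)"

section \<open>Divided power algebras\<close>

text \<open>Multi-indices \<open>(a\<^sub>1, \<dots>, a\<^sub>m)\<close> are functions that vanish outside \<open>{1..m}\<close>; only the values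
  of \<open>n\<close> on \<open>{1..m}\<close> matter.\<close>

definition multi_indices :: "nat \<Rightarrow> nat \<Rightarrow> (nat \<Rightarrow> nat) \<Rightarrow> (nat \<Rightarrow> nat) set" where
  "multi_indices p m n =
     {a. (\<forall>i\<in>{1..m}. a i < p ^ n i) \<and> (\<forall>i. i \<notin> {1..m} \<longrightarrow> a i = 0)}"

definition top_index :: "nat \<Rightarrow> nat \<Rightarrow> (nat \<Rightarrow> nat) \<Rightarrow> nat \<Rightarrow> nat" where
  "top_index p m n = (\<lambda>i. if i \<in> {1..m} then p ^ n i - 1 else 0)"

text \<open>An element of \<open>O(m; n)\<close> is its family of coefficients with respect to the basis of
  divided power monomials.\<close>

type_synonym 'a dpoly = "(nat \<Rightarrow> nat) \<Rightarrow> 'a"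

definition dp_monomial :: "(nat \<Rightarrow> nat) \<Rightarrow> 'a::field dpoly" where
  "dp_monomial a = (\<lambda>b. if b = a then 1 else 0)"

definition divided_power_algebra ::
    "nat \<Rightarrow> (nat \<Rightarrow> nat) \<Rightarrow> ('a::field, 'a dpoly) module" where
  "divided_power_algebra m n =
     (let I = multi_indices CHAR('a) m n in
      \<lparr>carrier = {f. \<forall>a. a \<notin> I \<longrightarrow> f a = 0},
       mult = (\<lambda>f g c. if c \<in> I
         then \<Sum>(a, b) \<in> {(a, b). a \<in> I \<and> b \<in> I \<and> (\<lambda>i. a i + b i) = c}.
                f a * g b * of_nat (\<Prod>i\<in>{1..m}. (a i + b i) choose b i)
         else 0),
       one = dp_monomial (\<lambda>_. 0),
       zero = (\<lambda>_. 0),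
       add = (\<lambda>f g a. f a + g a),
       smult = (\<lambda>c f a. c * f a)\<rparr>)"

text \<open>The linear extension of \<open>x\<^sup>(\<^sup>a\<^sup>) \<mapsto> x\<^sup>(\<^sup>a\<^sup>-\<^sup>\<epsilon>\<^sup>)\<close>, with \<open>\<epsilon>\<close> the \<open>i\<close>-th unit index,
  written on coefficients; see \<open>dp_partial_monomial\<close> below.\<close>

definition dp_partial :: "nat \<Rightarrow> 'a dpoly \<Rightarrow> 'a dpoly" where
  "dp_partial i f = (\<lambda>a. f (a(i := a i + 1)))"

lemma dp_partial_monomial:
  "dp_partial i (dp_monomial a) =
     (if a i = 0 then (\<lambda>_. 0) else dp_monomial (a(i := a i - 1)))"
  by (auto simp: dp_partial_def dp_monomial_def fun_eq_iff)

lemma finite_multi_indices: "finite (multi_indices p m n)"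
proof (rule finite_subset)
  show "multi_indices p m n \<subseteq>
      (\<lambda>f i. if i \<in> {1..m} then f i else 0) ` (\<Pi>\<^sub>E i\<in>{1..m}. {..<p ^ n i})"
  proof
    fix a assume a: "a \<in> multi_indices p m n"
    show "a \<in> (\<lambda>f i. if i \<in> {1..m} then f i else 0) ` (\<Pi>\<^sub>E i\<in>{1..m}. {..<p ^ n i})"
      by (rule image_eqI[of _ _ "restrict a {1..m}"])
        (use a in \<open>auto simp: multi_indices_def fun_eq_iff\<close>)
  qed
qed (intro finite_imageI finite_PiE, auto)

lemma dp_monomial_mult:
  fixes a b :: "nat \<Rightarrow> nat" and m :: nat and n :: "nat \<Rightarrow> nat"
  defines "O' \<equiv> (divided_power_algebra m n :: ('a::field, 'a dpoly) module)"
    and "I \<equiv> multi_indices CHAR('a) m n"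
  assumes "a \<in> I" "b \<in> I"
  shows "dp_monomial a \<otimes>\<^bsub>O'\<^esub> dp_monomial b =
    (if (\<lambda>i. a i + b i) \<in> I
     then of_nat (\<Prod>i\<in>{1..m}. (a i + b i) choose b i) \<odot>\<^bsub>O'\<^esub> dp_monomial (\<lambda>i. a i + b i)
     else \<zero>\<^bsub>O'\<^esub>)"
proof -
  let ?F = "\<lambda>(a', b'). dp_monomial a a' * dp_monomial b b'
      * (of_nat (\<Prod>i\<in>{1..m}. (a' i + b' i) choose b' i) :: 'a)"
  have "(\<Sum>x \<in> {(a', b'). a' \<in> I \<and> b' \<in> I \<and> (\<lambda>i. a' i + b' i) = c}. ?F x)
      = (if c = (\<lambda>i. a i + b i) then ?F (a, b) else 0)" (is "sum ?F ?S = _") for c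
  proof -
    have "finite ?S"
      by (rule finite_subset[of _ "I \<times> I"]) (auto simp: I_def finite_multi_indices)
    then have "sum ?F ?S = sum ?F (?S \<inter> {(a, b)})"
      by (intro sum.mono_neutral_right) (auto simp: dp_monomial_def split: if_splits)
    also have "?S \<inter> {(a, b)} = (if c = (\<lambda>i. a i + b i) then {(a, b)} else {})"
      using assms by auto
    finally show ?thesis by auto
  qed
  then have "(dp_monomial a \<otimes>\<^bsub>O'\<^esub> dp_monomial b) c =
      (if c \<in> I then if c = (\<lambda>i. a i + b i) then ?F (a, b) else 0 else 0)" for c
    by (simp add: O'_def divided_power_algebra_def Let_def I_def[symmetric] case_prod_unfold)
  then show ?thesis
    by (intro ext) (simp add: O'_def divided_power_algebra_def Let_def dp_monomial_def)
qed

section \<open>Generalized Jacobson-Witt and Hamiltonian algebras\<close>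

text \<open>The elements of \<open>W(m; n)\<close> are the operators \<open>g \<mapsto> \<Sum>\<^sub>i F\<^sub>i \<cdot> \<partial>\<^sub>i g\<close> on \<open>O(m; n)\<close>.\<close>

definition jacobson_witt_algebra ::
    "nat \<Rightarrow> (nat \<Rightarrow> nat) \<Rightarrow> ('a::field, 'a dpoly \<Rightarrow> 'a dpoly) lie_algebra" where
  "jacobson_witt_algebra m n =
     (let A = (divided_power_algebra m n :: ('a, 'a dpoly) module) in
      operator_lie_algebra A
        {restrict (\<lambda>g a. \<Sum>i\<in>{1..m}. (F i \<otimes>\<^bsub>A\<^esub> dp_partial i g) a) (carrier A) | F.
           \<forall>i\<in>{1..m}. F i \<in> carrier A})"

definition ham_sign :: "nat \<Rightarrow> nat \<Rightarrow> 'a::field" where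
  "ham_sign r i = (if i \<le> r then 1 else - 1)"

definition ham_conj :: "nat \<Rightarrow> nat \<Rightarrow> nat" where
  "ham_conj r i = (if i \<le> r then i + r else i - r)"

definition D_H ::
    "nat \<Rightarrow> (nat \<Rightarrow> nat) \<Rightarrow> 'a::field dpoly \<Rightarrow> 'a dpoly \<Rightarrow> 'a dpoly" where
  "D_H r n f =
     (let A = (divided_power_algebra (2 * r) n :: ('a, 'a dpoly) module) in
      restrict (\<lambda>g a. \<Sum>i\<in>{1..2 * r}.
          ham_sign r i * (dp_partial i f \<otimes>\<^bsub>A\<^esub> dp_partial (ham_conj r i) g) a) (carrier A))"

text \<open>The algebra \<open>H(2r; n)\<close> with superscript \<open>(2)\<close>.\<close>

definition hamiltonian_algebra ::
    "nat \<Rightarrow> (nat \<Rightarrow> nat) \<Rightarrow> ('a::field, 'a dpoly \<Rightarrow> 'a dpoly) lie_algebra" where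
  "hamiltonian_algebra r n =
     (let W = (jacobson_witt_algebra (2 * r) n :: ('a, 'a dpoly \<Rightarrow> 'a dpoly) lie_algebra) in
      W\<lparr>carrier := LinearCombinations.module.span class_ring W
          {D_H r n (dp_monomial a) | a.
             a \<in> multi_indices CHAR('a) (2 * r) n \<and>
             a \<noteq> (\<lambda>_. 0) \<and> a \<noteq> top_index CHAR('a) (2 * r) n}\<rparr>)"

end

theory Submission
  imports Defs
begin

text \<open>Write an element of \<open>O(2; (1, n))\<close> as \<open>f = f\<^sub>0 + x f\<^sub>1 + x\<^sup>(\<^sup>2\<^sup>) f\<^sub>2\<close>, where the \<open>f\<^sub>i\<close> are
  divided power series in \<open>y\<close>. In characteristic 3 the Hamiltonian bracket of \<open>f\<close> and \<open>g\<close> has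
  the components \<open>f\<^sub>1 g\<^sub>0' - f\<^sub>0' g\<^sub>1\<close>, \<open>(f\<^sub>1 g\<^sub>1' - f\<^sub>1' g\<^sub>1) + (f\<^sub>2 g\<^sub>0' - f\<^sub>0' g\<^sub>2)\<close> and
  \<open>(f\<^sub>1 g\<^sub>2 - f\<^sub>2 g\<^sub>1)'\<close>. Modulo constants, the pairs \<open>(f\<^sub>0', f\<^sub>2)\<close> and
  \<open>(g\<^sub>0', g\<^sub>2)\<close> enter only linearly or through their determinant. Hence
  \<open>sl\<^sub>2\<close> acts by derivations, sending \<open>f\<close> to \<open>x\<^sup>(\<^sup>2\<^sup>) f\<^sub>0'\<close>, to \<open>- f\<^sub>0 + x\<^sup>(\<^sup>2\<^sup>) f\<^sub>2\<close> and to an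
  antiderivative of \<open>f\<^sub>2\<close>. These derivations span a perfect algebra and the first one is outer, so
  their classes stay in the derived series of the outer derivation algebra forever.

  As for simplicity, bracketing with \<open>x\<close> and \<open>y\<close> lowers degrees, so that a nonzero ideal contains
  a nonzero linear form and then \<open>x\<close> and \<open>y\<close>. Hence it contains all monomials that are a partial
  derivative of another generator; the two remaining generators are eigenvectors of \<open>x y\<close> with
  nonzero eigenvalues.\<close>

section \<open>Hurwitz series\<close>

text \<open>A sequence \<open>f\<close> stands for the sum of all \<open>f k\<close> times y^(k), a
  series in divided powers of y. A product of such series is determined by its constant term and by
  the Leibniz rule for d/dy, which is the shift. With this recursion the ring laws become inductions
  on the index, free of binomial identities.\<close>

fun binomial_convolution :: "(nat \<Rightarrow> 'a::comm_ring_1) \<Rightarrow> (nat \<Rightarrow> 'a) \<Rightarrow> nat \<Rightarrow> 'a" where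
  "binomial_convolution f g 0 = f 0 * g 0"
| "binomial_convolution f g (Suc n) =
     binomial_convolution (\<lambda>k. f (Suc k)) g n + binomial_convolution f (\<lambda>k. g (Suc k)) n"

lemma binomial_convolution_add:
  "binomial_convolution (\<lambda>k. f k + f' k) g n = binomial_convolution f g n + binomial_convolution f' g n"
  by (induction n arbitrary: f f' g) (simp_all add: algebra_simps)

lemma binomial_convolution_commute: "binomial_convolution f g n = binomial_convolution g f n"
  by (induction n arbitrary: f g) (simp_all add: algebra_simps)

lemma binomial_convolution_zero: "binomial_convolution (\<lambda>k. 0) g n = 0"
  by (induction n arbitrary: g) simp_all

lemma binomial_convolution_one: "binomial_convolution (\<lambda>k. if k = 0 then 1 else 0) g n = g n"
  by (induction n arbitrary: g) (simp_all add: binomial_convolution_zero)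

lemma binomial_convolution_assoc:
  "binomial_convolution (binomial_convolution f g) h n = binomial_convolution f (binomial_convolution g h) n"
proof (induction n arbitrary: f g h)
  case 0
  show ?case by (simp add: mult.assoc)
next
  case (Suc n)
  \<comment> \<open>Additivity in the second argument is reduced to the first by
    commutativity.\<close>
  have "binomial_convolution u (\<lambda>k. v k + w k) n = binomial_convolution u v n + binomial_convolution u w n"
    for u v w :: "nat \<Rightarrow> 'a"
    by (subst (1 2 3) binomial_convolution_commute) (rule binomial_convolution_add)
  then show ?case by (simp add: Suc binomial_convolution_add add.assoc)
qed

text \<open>Pascal's rule adds the two sums that the recursion produces, once both run over the same
  range. This is the bridge to the explicit product of the divided power algebra.\<close>

lemma binomial_convolution_eq_sum:
  "binomial_convolution f g n = (\<Sum>k\<le>n. of_nat (n choose k) * f k * g (n - k))"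
proof (induction n arbitrary: f g)
  case 0
  show ?case by simp
next
  case (Suc n)
  let ?t = "\<lambda>c k. of_nat c * f k * g (Suc n - k)"
  have "(\<Sum>k\<le>n. of_nat (n choose k) * f (Suc k) * g (n - k))
      = (\<Sum>k\<in>{1..Suc n}. ?t (n choose (k - 1)) k)"
    by (rule sum.reindex_bij_witness[of _ "\<lambda>k. k - 1" Suc]) auto
  \<comment> \<open>The additional term at \<open>k = 0\<close> gets coefficient 0, as Pascal's rule
    expects there.\<close>
  also have "\<dots> = (\<Sum>k\<le>Suc n. ?t (if k = 0 then 0 else n choose (k - 1)) k)"
    by (rule sum.mono_neutral_cong_left) auto
  finally have 1: "(\<Sum>k\<le>n. of_nat (n choose k) * f (Suc k) * g (n - k))
      = (\<Sum>k\<le>Suc n. ?t (if k = 0 then 0 else n choose (k - 1)) k)" .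
  have 2: "(\<Sum>k\<le>n. of_nat (n choose k) * f k * g (Suc (n - k))) = (\<Sum>k\<le>Suc n. ?t (n choose k) k)"
    by (simp add: Suc_diff_le binomial_eq_0)
  have "binomial_convolution f g (Suc n)
      = (\<Sum>k\<le>Suc n. ?t (if k = 0 then 0 else n choose (k - 1)) k) + (\<Sum>k\<le>Suc n. ?t (n choose k) k)"
    by (simp only: binomial_convolution.simps Suc 1 2)
  also have "\<dots> = (\<Sum>k\<le>Suc n. ?t (Suc n choose k) k)"
    unfolding sum.distrib[symmetric]
  proof (rule sum.cong)
    fix k
    show "?t (if k = 0 then 0 else n choose (k - 1)) k + ?t (n choose k) k = ?t (Suc n choose k) k"
      by (cases k) (simp_all add: distrib_right)
  qed simp
  finally show ?case .
qed

text \<open>Series without a bound on the exponent form a type of class \<open>comm_ring_1\<close>,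
  so identities between rows can be settled by \<open>algebra_simps\<close>. The bound
  \<open>3 ^ n\<close> returns later as the predicate \<open>truncated\<close>.\<close>

typedef 'a hseries = "UNIV :: (nat \<Rightarrow> 'a) set"
  morphisms hs_nth Abs_hs by simp

setup_lifting type_definition_hseries

instantiation hseries :: (comm_ring_1) comm_ring_1
begin

lift_definition zero_hseries :: "'a hseries" is "\<lambda>k. 0" .
lift_definition one_hseries :: "'a hseries" is "\<lambda>k. if k = 0 then 1 else 0" .
lift_definition plus_hseries :: "'a hseries \<Rightarrow> 'a hseries \<Rightarrow> 'a hseries" is "\<lambda>f g k. f k + g k" .
lift_definition minus_hseries :: "'a hseries \<Rightarrow> 'a hseries \<Rightarrow> 'a hseries" is "\<lambda>f g k. f k - g k" .
lift_definition uminus_hseries :: "'a hseries \<Rightarrow> 'a hseries" is "\<lambda>f k. - f k" .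
lift_definition times_hseries :: "'a hseries \<Rightarrow> 'a hseries \<Rightarrow> 'a hseries" is binomial_convolution .

instance
proof
  show "a * b * c = a * (b * c)" for a b c :: "'a hseries"
    by transfer (simp add: fun_eq_iff binomial_convolution_assoc)
  show "a * b = b * a" for a b :: "'a hseries"
    by transfer (simp add: fun_eq_iff binomial_convolution_commute)
  show "1 * a = a" for a :: "'a hseries"
    by transfer (simp add: fun_eq_iff binomial_convolution_one)
  show "(a + b) * c = a * c + b * c" for a b c :: "'a hseries"
    by transfer (simp add: fun_eq_iff binomial_convolution_add)
  show "(0::'a hseries) \<noteq> 1"
    by transfer (auto simp: fun_eq_iff)
qed (transfer; simp add: fun_eq_iff algebra_simps)+

end

lemma hs_eqI: "(\<And>k. hs_nth f k = hs_nth g k) \<Longrightarrow> f = g"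
  by (simp add: hs_nth_inject[symmetric] fun_eq_iff)

lemma hs_nth_simps [simp]:
  "hs_nth 0 k = 0"
  "hs_nth (f + g) k = hs_nth f k + hs_nth g k"
  "hs_nth (f - g) k = hs_nth f k - hs_nth g k"
  "hs_nth (- f) k = - hs_nth f k"
  by (transfer; simp)+

lemma hs_nth_1: "hs_nth (1 :: 'a::comm_ring_1 hseries) k = (if k = 0 then 1 else 0)"
  by transfer simp

lemma hs_nth_mult: "hs_nth (f * g) k = (\<Sum>i\<le>k. of_nat (k choose i) * hs_nth f i * hs_nth g (k - i))"
  by transfer (rule binomial_convolution_eq_sum)

lemma three_hs_eq_0:
  assumes "(3 :: 'a::comm_ring_1) = 0"
  shows "(3 :: 'a hseries) = 0"
proof -
  have "1 + 1 + 1 = (0 :: 'a)"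
    using assms by simp
  then have "1 + 1 + 1 = (0 :: 'a hseries)"
    by (intro hs_eqI) (simp only: hs_nth_simps hs_nth_1, simp)
  then show ?thesis by simp
qed

lemma hs_nth_Abs [simp]: "hs_nth (Abs_hs u) = u"
  by (simp add: Abs_hs_inverse)

text \<open>In divided powers d/dy is a shift without numerical factors, so antiderivatives exist in
  every characteristic.\<close>

lift_definition hs_deriv :: "'a hseries \<Rightarrow> 'a hseries" is "\<lambda>f k. f (Suc k)" .

lift_definition hs_integral :: "'a::zero hseries \<Rightarrow> 'a hseries" is
  "\<lambda>f k. case k of 0 \<Rightarrow> 0 | Suc j \<Rightarrow> f j" .

lemma hs_nth_deriv [simp]: "hs_nth (hs_deriv f) k = hs_nth f (Suc k)"
  by transfer simp

lemma hs_nth_integral: "hs_nth (hs_integral f) k = (if k = 0 then 0 else hs_nth f (k - 1))"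
  by transfer (simp split: nat.split)

lemma hs_deriv_simps [simp]:
  fixes f g :: "'a::comm_ring_1 hseries"
  shows "hs_deriv (0 :: 'a hseries) = 0"
  "hs_deriv (f + g) = hs_deriv f + hs_deriv g"
  "hs_deriv (f - g) = hs_deriv f - hs_deriv g"
  "hs_deriv (- f) = - hs_deriv f"
  "hs_deriv (hs_integral f) = f"
  by (rule hs_eqI; simp add: hs_nth_integral)+

lemma hs_deriv_mult [simp]: "hs_deriv (f * g) = hs_deriv f * g + f * hs_deriv g"
  by transfer (simp add: fun_eq_iff)

section \<open>Powers of derivations in characteristic 3\<close>

definition is_derivation :: "('a::comm_ring_1 \<Rightarrow> 'a) \<Rightarrow> bool" where
  "is_derivation D \<longleftrightarrow> (\<forall>f g. D (f + g) = D f + D g \<and> D (f * g) = D f * g + f * D g)"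

text \<open>In the Leibniz formula for the third power of a derivation both mixed terms carry the
  binomial coefficient 3.\<close>

lemma is_derivation_funpow_3:
  fixes D :: "'a::comm_ring_1 \<Rightarrow> 'a"
  assumes "is_derivation D" and 3: "(3 :: 'a) = 0"
  shows "is_derivation (D ^^ 3)"
proof -
  have add: "D (f + g) = D f + D g" and mult: "D (f * g) = D f * g + f * D g" for f g
    using assms(1) by (simp_all add: is_derivation_def)
  have "D (D (D (f * g))) = D (D (D f)) * g + f * D (D (D g)) + 3 * (D (D f) * D g + D f * D (D g))"
    for f g
    by (simp only: add mult) (simp add: algebra_simps)
  then show ?thesis
    by (simp add: is_derivation_def numeral_3_eq_3 add 3)
qed

lemma is_derivation_funpow_power_3:
  fixes D :: "'a::comm_ring_1 \<Rightarrow> 'a"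
  assumes "is_derivation D" and "(3 :: 'a) = 0"
  shows "is_derivation (D ^^ (3 ^ n))"
proof (induction n)
  case (Suc n)
  then show ?case
    using is_derivation_funpow_3[of "D ^^ (3 ^ n)"] assms(2)
    by (simp add: funpow_mult mult.commute)
qed (use assms(1) in simp)

lemma hs_nth_funpow_deriv: "hs_nth ((hs_deriv ^^ q) f) k = hs_nth f (k + q)"
  by (induction q arbitrary: k) simp_all

text \<open>In characteristic 3, divided powers \<open>y\<^sup>(\<^sup>j\<^sup>)\<close> with \<open>j < 3\<^sup>n\<close> are the kernel of the
  derivation \<open>(d/dy)\<^sup>q\<close> for \<open>q = 3\<^sup>n\<close>, hence a subalgebra.\<close>

lemma hs_nth_mult_eq_0:
  fixes f g :: "'a::comm_ring_1 hseries"
  assumes "(3 :: 'a) = 0"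
    and "\<And>k. k \<ge> 3 ^ n \<Longrightarrow> hs_nth f k = 0" "\<And>k. k \<ge> 3 ^ n \<Longrightarrow> hs_nth g k = 0" "k \<ge> 3 ^ n"
  shows "hs_nth (f * g) k = 0"
proof -
  have h: "(hs_deriv ^^ (3 ^ n)) u = 0" if "\<And>k. k \<ge> 3 ^ n \<Longrightarrow> hs_nth u k = 0" for u :: "'a hseries"
    by (rule hs_eqI) (simp add: hs_nth_funpow_deriv that)
  have "(3 :: 'a hseries) = 0"
    by (rule three_hs_eq_0) fact
  moreover have "is_derivation (hs_deriv :: 'a hseries \<Rightarrow> _)"
    by (simp add: is_derivation_def)
  ultimately have "is_derivation (hs_deriv ^^ (3 ^ n) :: 'a hseries \<Rightarrow> _)"
    by (intro is_derivation_funpow_power_3)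
  then have "(hs_deriv ^^ (3 ^ n)) (f * g) = 0"
    using h[of f] h[of g] assms by (simp add: is_derivation_def)
  \<comment> \<open>The iterated shift takes coefficient \<open>k\<close> to position
    \<open>k - 3 ^ n\<close>, a genuine difference since \<open>k\<close> is at least
    \<open>3 ^ n\<close>.\<close>
  then have "hs_nth ((hs_deriv ^^ (3 ^ n)) (f * g)) (k - 3 ^ n) = 0" by simp
  then show ?thesis using assms(4) by (simp only: hs_nth_funpow_deriv) simp
qed

section \<open>Lie algebras of operators\<close>

lemma operator_lie_algebra_simps [simp]:
  "carrier (operator_lie_algebra V S) = S"
  "\<zero>\<^bsub>operator_lie_algebra V S\<^esub> = restrict (\<lambda>x. \<zero>\<^bsub>V\<^esub>) (carrier V)"
  "D \<oplus>\<^bsub>operator_lie_algebra V S\<^esub> E = restrict (\<lambda>x. D x \<oplus>\<^bsub>V\<^esub> E x) (carrier V)"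
  "c \<odot>\<^bsub>operator_lie_algebra V S\<^esub> D = restrict (\<lambda>x. c \<odot>\<^bsub>V\<^esub> D x) (carrier V)"
  "bracket (operator_lie_algebra V S) D E = restrict (\<lambda>x. D (E x) \<ominus>\<^bsub>V\<^esub> E (D x)) (carrier V)"
  by (simp_all add: operator_lie_algebra_def)

lemma restrict_eq_extensionalI:
  "D \<in> extensional A \<Longrightarrow> (\<And>x. x \<in> A \<Longrightarrow> f x = D x) \<Longrightarrow> restrict f A = D"
  by (auto simp: extensional_def fun_eq_iff)

lemma restrict_eqI: "(\<And>x. x \<in> A \<Longrightarrow> f x = g x) \<Longrightarrow> restrict f A = restrict g A"
  by (auto simp: fun_eq_iff)

lemma module_hom_dest:
  assumes "D \<in> LinearCombinations.module_hom R M N"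
  shows "x \<in> carrier M \<Longrightarrow> D x \<in> carrier N"
    and "x \<in> carrier M \<Longrightarrow> y \<in> carrier M \<Longrightarrow> D (x \<oplus>\<^bsub>M\<^esub> y) = D x \<oplus>\<^bsub>N\<^esub> D y"
    and "c \<in> carrier R \<Longrightarrow> x \<in> carrier M \<Longrightarrow> D (c \<odot>\<^bsub>M\<^esub> x) = c \<odot>\<^bsub>N\<^esub> D x"
  using assms by (auto simp: LinearCombinations.module_hom_def)

context Module.module
begin

lemma minus_smult_minus_1: "x \<in> carrier M \<Longrightarrow> \<ominus>\<^bsub>M\<^esub> x = (\<ominus> \<one>) \<odot>\<^bsub>M\<^esub> x"
  by (simp add: smult_minus_1)

lemma module_hom_minus:
  assumes "D \<in> LinearCombinations.module_hom R M M" "x \<in> carrier M" "y \<in> carrier M"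
  shows "D (x \<ominus>\<^bsub>M\<^esub> y) = D x \<ominus>\<^bsub>M\<^esub> D y"
  using module_hom_dest[OF assms(1)] assms(2,3)
  by (simp add: M.minus_eq minus_smult_minus_1)

lemma minus_minus_minus:
  assumes "a \<in> carrier M" "b \<in> carrier M" "c \<in> carrier M" "d \<in> carrier M"
  shows "(a \<oplus>\<^bsub>M\<^esub> b) \<ominus>\<^bsub>M\<^esub> (c \<oplus>\<^bsub>M\<^esub> d) = (a \<ominus>\<^bsub>M\<^esub> c) \<oplus>\<^bsub>M\<^esub> (b \<ominus>\<^bsub>M\<^esub> d)"
  using assms by (simp add: M.minus_eq M.minus_add M.a_ac)

lemma smult_minus_distrib:
  assumes "c \<in> carrier R" "a \<in> carrier M" "b \<in> carrier M"
  shows "c \<odot>\<^bsub>M\<^esub> (a \<ominus>\<^bsub>M\<^esub> b) = c \<odot>\<^bsub>M\<^esub> a \<ominus>\<^bsub>M\<^esub> c \<odot>\<^bsub>M\<^esub> b"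
  using assms by (simp add: M.minus_eq smult_r_distr smult_r_minus)

lemma operator_module:
  assumes S: "S \<subseteq> LinearCombinations.module_hom R M M \<inter> extensional (carrier M)"
    and zero: "restrict (\<lambda>x. \<zero>\<^bsub>M\<^esub>) (carrier M) \<in> S"
    and add: "\<And>D E. D \<in> S \<Longrightarrow> E \<in> S \<Longrightarrow> restrict (\<lambda>x. D x \<oplus>\<^bsub>M\<^esub> E x) (carrier M) \<in> S"
    and smult: "\<And>c D. c \<in> carrier R \<Longrightarrow> D \<in> S \<Longrightarrow> restrict (\<lambda>x. c \<odot>\<^bsub>M\<^esub> D x) (carrier M) \<in> S"
  shows "Module.module R (operator_lie_algebra M S)"
proof -
  have hom: "D x \<in> carrier M" if "D \<in> S" "x \<in> carrier M" for D x
    using S that by (blast dest: module_hom_dest)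
  have ext: "D \<in> extensional (carrier M)" if "D \<in> S" for D
    using S that by auto
  note [simp] = hom
  show ?thesis
  proof (rule module_criteria, goal_cases)
    case 1
    show ?case by unfold_locales
  next
    case 4
    \<comment> \<open>Case 4 asks for additive inverses; scalar multiplication by -1 provides them
      inside \<open>S\<close>.\<close>
    have "restrict (\<lambda>x. D x \<oplus>\<^bsub>M\<^esub> restrict (\<lambda>x. (\<ominus> \<one>) \<odot>\<^bsub>M\<^esub> D x) (carrier M) x) (carrier M)
        = restrict (\<lambda>x. \<zero>\<^bsub>M\<^esub>) (carrier M)" if "D \<in> S" for D
      using that by (intro restrict_eqI) (simp add: minus_smult_minus_1[symmetric] M.r_neg)
    then show ?case using smult by (auto intro!: bexI[rotated, OF smult[of "\<ominus> \<one>"]])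
  qed (auto simp: zero add smult M.a_ac smult_assoc1 smult_l_distr smult_r_distr
      intro!: restrict_eqI restrict_eq_extensionalI ext)
qed

text \<open>Commutators of linear operators satisfy the Lie axioms automatically, so the assumptions
  on \<open>S\<close> are linearity and closure. The lemma serves twice: for the derivations of a
  Lie algebra and for the Hamiltonian operators.\<close>

lemma operator_lie_algebra_lie:
  assumes S: "S \<subseteq> LinearCombinations.module_hom R M M \<inter> extensional (carrier M)"
    and zero: "restrict (\<lambda>x. \<zero>\<^bsub>M\<^esub>) (carrier M) \<in> S"
    and add: "\<And>D E. D \<in> S \<Longrightarrow> E \<in> S \<Longrightarrow> restrict (\<lambda>x. D x \<oplus>\<^bsub>M\<^esub> E x) (carrier M) \<in> S"
    and smult: "\<And>c D. c \<in> carrier R \<Longrightarrow> D \<in> S \<Longrightarrow> restrict (\<lambda>x. c \<odot>\<^bsub>M\<^esub> D x) (carrier M) \<in> S"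
    and bracket: "\<And>D E. D \<in> S \<Longrightarrow> E \<in> S \<Longrightarrow>
      restrict (\<lambda>x. D (E x) \<ominus>\<^bsub>M\<^esub> E (D x)) (carrier M) \<in> S"
    and field: "field R"
  shows "lie_algebra R (operator_lie_algebra M S)"
proof -
  have hom: "D x \<in> carrier M" if "D \<in> S" "x \<in> carrier M" for D x
    using S that by (blast dest: module_hom_dest)
  have lin: "D (x \<oplus>\<^bsub>M\<^esub> y) = D x \<oplus>\<^bsub>M\<^esub> D y" "D (x \<ominus>\<^bsub>M\<^esub> y) = D x \<ominus>\<^bsub>M\<^esub> D y"
    if "D \<in> S" "x \<in> carrier M" "y \<in> carrier M" for D x y
    using S that module_hom_dest(2)[of D R M M] module_hom_minus[of D] by blast+
  have sm: "D (c \<odot>\<^bsub>M\<^esub> x) = c \<odot>\<^bsub>M\<^esub> D x"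
    if "D \<in> S" "x \<in> carrier M" "c \<in> carrier R" for D x c
    using S that by (blast dest: module_hom_dest)
  interpret O: Module.module R "operator_lie_algebra M S"
    by (rule operator_module) fact+
  interpret field R by fact
  note [simp] = hom lin sm
  show ?thesis
  proof (unfold_locales, goal_cases)
    case 1
    then show ?case by (simp add: bracket)
  next
    case 2
    then show ?case by (auto intro!: restrict_eqI simp: minus_minus_minus)
  next
    case 3
    then show ?case by (auto intro!: restrict_eqI simp: minus_minus_minus)
  next
    case 4
    then show ?case by (auto intro!: restrict_eqI simp: smult_minus_distrib)
  next
    case 5
    then show ?case by (auto intro!: restrict_eqI simp: smult_minus_distrib)
  next
    case 6
    then show ?case by (auto intro!: restrict_eqI simp: M.minus_eq M.r_neg)
  next
    case (7 D E F)
    have "(D (E (F x)) \<ominus>\<^bsub>M\<^esub> D (F (E x)) \<ominus>\<^bsub>M\<^esub> (E (F (D x)) \<ominus>\<^bsub>M\<^esub> F (E (D x))))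
        \<oplus>\<^bsub>M\<^esub> (E (F (D x)) \<ominus>\<^bsub>M\<^esub> E (D (F x)) \<ominus>\<^bsub>M\<^esub> (F (D (E x)) \<ominus>\<^bsub>M\<^esub> D (F (E x))))
        \<oplus>\<^bsub>M\<^esub> (F (D (E x)) \<ominus>\<^bsub>M\<^esub> F (E (D x)) \<ominus>\<^bsub>M\<^esub> (D (E (F x)) \<ominus>\<^bsub>M\<^esub> E (D (F x)))) = \<zero>\<^bsub>M\<^esub>"
      if "x \<in> carrier M" for x
    proof -
      \<comment> \<open>The letters \<open>a\<close> to \<open>f\<close> stand for the six
        compositions of \<open>D\<close>, \<open>E\<close> and \<open>F\<close> at \<open>x\<close>;
        each occurs once with either sign.\<close>
      have key: "(a \<ominus>\<^bsub>M\<^esub> b \<ominus>\<^bsub>M\<^esub> (c \<ominus>\<^bsub>M\<^esub> d)) \<oplus>\<^bsub>M\<^esub> (c \<ominus>\<^bsub>M\<^esub> e \<ominus>\<^bsub>M\<^esub> (f \<ominus>\<^bsub>M\<^esub> b))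
        \<oplus>\<^bsub>M\<^esub> (f \<ominus>\<^bsub>M\<^esub> d \<ominus>\<^bsub>M\<^esub> (a \<ominus>\<^bsub>M\<^esub> e)) = \<zero>\<^bsub>M\<^esub>"
        if "a \<in> carrier M" "b \<in> carrier M" "c \<in> carrier M" "d \<in> carrier M" "e \<in> carrier M"
          "f \<in> carrier M" for a b c d e f
      proof -
        have "(a \<ominus>\<^bsub>M\<^esub> b \<ominus>\<^bsub>M\<^esub> (c \<ominus>\<^bsub>M\<^esub> d)) \<oplus>\<^bsub>M\<^esub> (c \<ominus>\<^bsub>M\<^esub> e \<ominus>\<^bsub>M\<^esub> (f \<ominus>\<^bsub>M\<^esub> b))
            \<oplus>\<^bsub>M\<^esub> (f \<ominus>\<^bsub>M\<^esub> d \<ominus>\<^bsub>M\<^esub> (a \<ominus>\<^bsub>M\<^esub> e))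
          = (a \<oplus>\<^bsub>M\<^esub> \<ominus>\<^bsub>M\<^esub> a) \<oplus>\<^bsub>M\<^esub> ((b \<oplus>\<^bsub>M\<^esub> \<ominus>\<^bsub>M\<^esub> b) \<oplus>\<^bsub>M\<^esub> ((c \<oplus>\<^bsub>M\<^esub> \<ominus>\<^bsub>M\<^esub> c) \<oplus>\<^bsub>M\<^esub>
              ((d \<oplus>\<^bsub>M\<^esub> \<ominus>\<^bsub>M\<^esub> d) \<oplus>\<^bsub>M\<^esub> ((e \<oplus>\<^bsub>M\<^esub> \<ominus>\<^bsub>M\<^esub> e) \<oplus>\<^bsub>M\<^esub> (f \<oplus>\<^bsub>M\<^esub> \<ominus>\<^bsub>M\<^esub> f)))))"
          using that by (simp add: M.minus_eq M.minus_add M.a_ac del: M.r_neg M.l_neg)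
        also have "\<dots> = \<zero>\<^bsub>M\<^esub>"
          using that by (simp add: M.r_neg)
        finally show ?thesis .
      qed
      show ?thesis using that 7 by (intro key) simp_all
    qed
    then show ?case using 7 by (auto intro!: restrict_eqI)
  qed
qed

end

section \<open>Derivations of a Lie algebra and the ideal of inner derivations\<close>

context lie_algebra
begin

lemma bracket_minus_left:
  assumes "x \<in> carrier L" "y \<in> carrier L" "z \<in> carrier L"
  shows "bracket L (x \<ominus> y) z = bracket L x z \<ominus> bracket L y z"
  using assms by (simp add: minus_eq minus_smult_minus_1 bracket_add_left bracket_smult_left bracket_closed)

lemma bracket_minus_right:
  assumes "x \<in> carrier L" "y \<in> carrier L" "z \<in> carrier L"
  shows "bracket L x (y \<ominus> z) = bracket L x y \<ominus> bracket L x z"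
  using assms by (simp add: minus_eq minus_smult_minus_1 bracket_add_right bracket_smult_right bracket_closed)

lemma bracket_zero_left [simp]:
  assumes "x \<in> carrier L"
  shows "bracket L \<zero> x = \<zero>"
  using bracket_minus_left[OF assms assms assms] assms
  by (simp add: minus_eq r_neg bracket_closed)

lemma bracket_zero_right [simp]:
  assumes "x \<in> carrier L"
  shows "bracket L x \<zero> = \<zero>"
  using bracket_minus_right[OF assms assms assms] assms
  by (simp add: minus_eq r_neg bracket_closed)

text \<open>Polarisation of \<open>bracket_self\<close>, applied to the sum of \<open>x\<close> and
  \<open>y\<close>.\<close>

lemma bracket_anticommute:
  assumes "x \<in> carrier L" "y \<in> carrier L"
  shows "bracket L x y = \<ominus> bracket L y x"
proof -
  have "\<zero> = bracket L (x \<oplus> y) (x \<oplus> y)"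
    using assms by (simp add: bracket_self)
  also have "\<dots> = (bracket L x x \<oplus> bracket L x y) \<oplus> (bracket L y x \<oplus> bracket L y y)"
    using assms by (simp add: bracket_add_left bracket_add_right bracket_closed a_ac)
  also have "\<dots> = bracket L x y \<oplus> bracket L y x"
    using assms by (simp add: bracket_closed bracket_self)
  finally show ?thesis
    using assms by (metis bracket_closed minus_equality)
qed

text \<open>The definition of \<open>lie_ideal\<close> has the ideal in the second slot.
  Anticommutativity moves it to the first at the price of the scalar -1, under which a submodule is
  closed.\<close>

lemma lie_ideal_bracket_left:
  assumes I: "lie_ideal K L I" and "x \<in> I" "y \<in> carrier L"
  shows "bracket L x y \<in> I"
proof -
  interpret I: LinearCombinations.submodule K I L
    using I by (simp add: lie_ideal_def)
  have "x \<in> carrier L" using assms I.subset by auto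
  then have "bracket L x y = (\<ominus>\<^bsub>K\<^esub> \<one>\<^bsub>K\<^esub>) \<odot> bracket L y x"
    using assms(3) by (simp add: bracket_anticommute[of x y] minus_smult_minus_1 bracket_closed)
  then show ?thesis
    using assms by (simp add: lie_ideal_def)
qed

lemma derivationsD:
  assumes "D \<in> derivations K L"
  shows "D \<in> LinearCombinations.module_hom K L L" "D \<in> extensional (carrier L)"
    and "x \<in> carrier L \<Longrightarrow> D x \<in> carrier L"
    and "x \<in> carrier L \<Longrightarrow> y \<in> carrier L \<Longrightarrow> D (x \<oplus> y) = D x \<oplus> D y"
    and "x \<in> carrier L \<Longrightarrow> y \<in> carrier L \<Longrightarrow> D (x \<ominus> y) = D x \<ominus> D y"
    and "c \<in> carrier K \<Longrightarrow> x \<in> carrier L \<Longrightarrow> D (c \<odot> x) = c \<odot> D x"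
    and "x \<in> carrier L \<Longrightarrow> y \<in> carrier L \<Longrightarrow>
      D (bracket L x y) = bracket L (D x) y \<oplus> bracket L x (D y)"
  using assms module_hom_dest[of D K L L] module_hom_minus[of D x y] by (auto simp: derivations_def)

lemma derivationsI:
  assumes "D \<in> extensional (carrier L)"
    and "\<And>x. x \<in> carrier L \<Longrightarrow> D x \<in> carrier L"
    and "\<And>x y. x \<in> carrier L \<Longrightarrow> y \<in> carrier L \<Longrightarrow> D (x \<oplus> y) = D x \<oplus> D y"
    and "\<And>c x. c \<in> carrier K \<Longrightarrow> x \<in> carrier L \<Longrightarrow> D (c \<odot> x) = c \<odot> D x"
    and "\<And>x y. x \<in> carrier L \<Longrightarrow> y \<in> carrier L \<Longrightarrow>
      D (bracket L x y) = bracket L (D x) y \<oplus> bracket L x (D y)"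
  shows "D \<in> derivations K L"
  using assms by (auto simp: derivations_def LinearCombinations.module_hom_def)

lemma commutator_derivation:
  assumes D: "D \<in> derivations K L" and E: "E \<in> derivations K L"
  shows "restrict (\<lambda>x. D (E x) \<ominus> E (D x)) (carrier L) \<in> derivations K L"
proof -
  note [simp] = derivationsD(3-7)[OF D] derivationsD(3-7)[OF E] bracket_closed
  show ?thesis
  proof (rule derivationsI, goal_cases)
    case (5 x y)
    \<comment> \<open>The letters \<open>b\<close> and \<open>c\<close> stand for the mixed brackets
      of \<open>E x\<close> with \<open>D y\<close> and of \<open>D x\<close> with
      \<open>E y\<close>. Both orders of composition produce them, so they cancel.\<close>
    have key: "((a \<oplus> b) \<oplus> (c \<oplus> d)) \<ominus> ((e \<oplus> c) \<oplus> (b \<oplus> f)) = (a \<ominus> e) \<oplus> (d \<ominus> f)"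
      if "a \<in> carrier L" "b \<in> carrier L" "c \<in> carrier L" "d \<in> carrier L" "e \<in> carrier L"
        "f \<in> carrier L" for a b c d e f
    proof -
      have "((a \<oplus> b) \<oplus> (c \<oplus> d)) \<ominus> ((e \<oplus> c) \<oplus> (b \<oplus> f))
          = (a \<ominus> e) \<oplus> (d \<ominus> f) \<oplus> ((b \<oplus> \<ominus> b) \<oplus> (c \<oplus> \<ominus> c))"
        using that by (simp add: minus_eq minus_add a_ac del: r_neg l_neg)
      also have "\<dots> = (a \<ominus> e) \<oplus> (d \<ominus> f)"
        using that by (simp add: r_neg)
      finally show ?thesis .
    qed
    show ?case
      using 5 by (simp add: bracket_minus_left bracket_minus_right key)
  qed (simp_all add: minus_minus_minus smult_minus_distrib)
qed

lemma Der_lie_algebra: "lie_algebra K (Der K L)"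
  unfolding Der_def
proof (rule operator_lie_algebra_lie)
  show "derivations K L \<subseteq> LinearCombinations.module_hom K L L \<inter> extensional (carrier L)"
    using derivationsD(1,2) by blast
  show "restrict (\<lambda>x. \<zero>) (carrier L) \<in> derivations K L"
  proof (rule derivationsI)
    show "restrict (\<lambda>x. \<zero>) (carrier L) (bracket L x y) =
        bracket L (restrict (\<lambda>x. \<zero>) (carrier L) x) y \<oplus> bracket L x (restrict (\<lambda>x. \<zero>) (carrier L) y)"
      if "x \<in> carrier L" "y \<in> carrier L" for x y
      using that by (simp add: bracket_closed)
  qed auto
  show "restrict (\<lambda>x. D x \<oplus> E x) (carrier L) \<in> derivations K L"
    if D: "D \<in> derivations K L" and E: "E \<in> derivations K L" for D E
    using derivationsD(3-7)[OF D] derivationsD(3-7)[OF E]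
    by (intro derivationsI)
      (simp_all add: bracket_closed bracket_add_left bracket_add_right smult_r_distr a_ac)
  show "restrict (\<lambda>x. c \<odot> D x) (carrier L) \<in> derivations K L"
    if c: "c \<in> carrier K" and D: "D \<in> derivations K L" for c D
  proof (rule derivationsI)
    show "restrict (\<lambda>x. c \<odot> D x) (carrier L) (b \<odot> x) = b \<odot> restrict (\<lambda>x. c \<odot> D x) (carrier L) x"
      if "b \<in> carrier K" "x \<in> carrier L" for b x
      using that c derivationsD(3,6)[OF D] by (simp add: smult_assoc1[symmetric] m_comm)
  qed (use c derivationsD(3-7)[OF D] in
      \<open>simp_all add: bracket_closed bracket_smult_left bracket_smult_right smult_r_distr\<close>)
qed (use commutator_derivation in \<open>unfold_locales, auto\<close>)

text \<open>The Jacobi identity, solved for its third summand, is the Leibniz rule for the bracket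
  with \<open>z\<close>.\<close>

lemma inner_derivation_in_derivations:
  assumes z: "z \<in> carrier L"
  shows "restrict (bracket L z) (carrier L) \<in> derivations K L"
proof (rule derivationsI, goal_cases)
  case (5 x y)
  have "bracket L z (bracket L x y) = \<ominus> (bracket L x (bracket L y z) \<oplus> bracket L y (bracket L z x))"
    using 5 z jacobi[of x y z] by (metis bracket_closed a_closed a_comm minus_equality)
  also have "\<dots> = bracket L (bracket L z x) y \<oplus> bracket L x (bracket L z y)"
  proof -
    have "bracket L x (bracket L z y) = \<ominus> bracket L x (bracket L y z)"
      using 5 z bracket_smult_right[of "\<ominus>\<^bsub>K\<^esub> \<one>\<^bsub>K\<^esub>" x "bracket L y z"]
        bracket_anticommute[of z y] by (simp add: minus_smult_minus_1 bracket_closed)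
    moreover have "bracket L (bracket L z x) y = \<ominus> bracket L y (bracket L z x)"
      using 5 z by (intro bracket_anticommute) (simp_all add: bracket_closed)
    ultimately show ?thesis
      using 5 z by (simp add: bracket_closed minus_add a_comm)
  qed
  finally show ?case
    using 5 z by (simp add: bracket_closed)
qed (use z in \<open>simp_all add: bracket_closed bracket_add_right bracket_smult_right\<close>)

text \<open>The sum of ad y and ad z is ad (y + z), and the negative of ad z is ad (- z). Phrasing
  this as \<open>abelian_subgroup\<close> gives access to the coset calculus of HOL-Algebra.\<close>

lemma inner_derivations_abelian_subgroup: "abelian_subgroup (inner_derivations L) (Der K L)"
proof -
  interpret D: lie_algebra K "Der K L" by (rule Der_lie_algebra)
  have [simp]: "carrier (Der K L) = derivations K L" "\<zero>\<^bsub>Der K L\<^esub> = restrict (\<lambda>x. \<zero>) (carrier L)"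
    "\<And>D E. D \<oplus>\<^bsub>Der K L\<^esub> E = restrict (\<lambda>x. D x \<oplus> E x) (carrier L)"
    by (simp_all add: Der_def)
  have "subgroup (inner_derivations L) (add_monoid (Der K L))"
  proof (rule D.add.subgroupI, goal_cases)
    case 1
    then show ?case by (auto simp: inner_derivations_def inner_derivation_in_derivations)
  next
    case 2
    then show ?case by (auto simp: inner_derivations_def)
  next
    case (3 D)
    then obtain z where z: "z \<in> carrier L" "D = restrict (bracket L z) (carrier L)"
      by (auto simp: inner_derivations_def)
    have "bracket L (\<ominus> z) x = \<ominus> bracket L z x" if "x \<in> carrier L" for x
      using z that bracket_minus_left[of \<zero> z x] by (simp add: minus_eq bracket_closed)
    then have "\<ominus>\<^bsub>Der K L\<^esub> D = restrict (bracket L (\<ominus> z)) (carrier L)"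
      using z by (intro D.minus_equality)
        (auto simp: inner_derivation_in_derivations bracket_closed l_neg intro!: restrict_eqI)
    then show ?case
      using z by (auto simp: inner_derivations_def a_inv_def[symmetric])
  next
    case (4 D E)
    then obtain y z where "y \<in> carrier L" "D = restrict (bracket L y) (carrier L)"
        "z \<in> carrier L" "E = restrict (bracket L z) (carrier L)"
      by (auto simp: inner_derivations_def)
    then show ?case
      by (auto simp: inner_derivations_def bracket_add_left intro!: image_eqI[of _ _ "y \<oplus> z"] restrict_eqI)
  qed
  then show ?thesis
    by (intro abelian_subgroupI3 additive_subgroup.intro D.abelian_group_axioms)
qed

text \<open>The commutator of a derivation D with ad z is ad (D z), so the inner derivations are
  stable under brackets from both sides.\<close>

lemma Der_bracket_inner:
  assumes D: "D \<in> derivations K L" and E: "E \<in> inner_derivations L"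
  shows "bracket (Der K L) D E \<in> inner_derivations L" "bracket (Der K L) E D \<in> inner_derivations L"
proof -
  from E obtain z where z: "z \<in> carrier L" "E = restrict (bracket L z) (carrier L)"
    by (auto simp: inner_derivations_def)
  interpret S: abelian_subgroup "inner_derivations L" "Der K L"
    by (rule inner_derivations_abelian_subgroup)
  interpret D: lie_algebra K "Der K L" by (rule Der_lie_algebra)
  have "bracket (Der K L) D E = restrict (bracket L (D z)) (carrier L)"
    using z derivationsD(3,7)[OF D]
    by (auto simp: Der_def bracket_closed minus_eq a_assoc r_neg intro!: restrict_eqI)
  then show 1: "bracket (Der K L) D E \<in> inner_derivations L"
    using z derivationsD(3)[OF D] by (auto simp: inner_derivations_def)
  have "D \<in> carrier (Der K L)" "E \<in> carrier (Der K L)"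
    using D z by (simp_all add: Der_def inner_derivation_in_derivations)
  from D.bracket_anticommute[OF this(2,1)] show "bracket (Der K L) E D \<in> inner_derivations L"
    using 1 by (simp add: S.a_inv_closed)
qed

section \<open>The outer derivation algebra as a set of cosets\<close>

abbreviation outer_class :: "('b \<Rightarrow> 'b) \<Rightarrow> ('b \<Rightarrow> 'b) set" where
  "outer_class D \<equiv> inner_derivations L +>\<^bsub>Der K L\<^esub> D"

lemma outer_class_cong:
  assumes "D \<in> derivations K L" "E \<in> outer_class D"
  shows "outer_class E = outer_class D"
proof -
  interpret S: abelian_subgroup "inner_derivations L" "Der K L"
    by (rule inner_derivations_abelian_subgroup)
  show ?thesis
    using S.a_repr_independence[OF assms(2) _ S.a_subgroup] assms(1) by (simp add: Der_def)
qed

lemma Out_carrier: "carrier (Out K L) = outer_class ` derivations K L"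
  by (auto simp: Out_def lie_quotient_def A_RCOSETS_def RCOSETS_def a_r_coset_def Der_def)

lemma Out_zero: "\<zero>\<^bsub>Out K L\<^esub> = outer_class \<zero>\<^bsub>Der K L\<^esub>"
proof -
  interpret S: abelian_subgroup "inner_derivations L" "Der K L"
    by (rule inner_derivations_abelian_subgroup)
  show ?thesis
    using S.a_coset_add_zero[OF S.a_subset] by (simp add: Out_def lie_quotient_def)
qed

text \<open>\<open>lie_quotient\<close> defines scalar multiples and brackets as unions over all
  representatives. Each member of such a union is shown to be the same coset; as cosets are
  nonempty, the union is that coset.\<close>

lemma Out_operations:
  assumes D: "D \<in> derivations K L" and E: "E \<in> derivations K L"
  shows Out_add: "outer_class D \<oplus>\<^bsub>Out K L\<^esub> outer_class E = outer_class (D \<oplus>\<^bsub>Der K L\<^esub> E)"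
    and Out_smult: "c \<in> carrier K \<Longrightarrow> c \<odot>\<^bsub>Out K L\<^esub> outer_class D = outer_class (c \<odot>\<^bsub>Der K L\<^esub> D)"
    and Out_bracket: "bracket (Out K L) (outer_class D) (outer_class E) = outer_class (bracket (Der K L) D E)"
proof -
  interpret D: lie_algebra K "Der K L" by (rule Der_lie_algebra)
  interpret S: abelian_subgroup "inner_derivations L" "Der K L"
    by (rule inner_derivations_abelian_subgroup)
  let ?I = "inner_derivations L"
  have [simp]: "D \<in> carrier (Der K L)" "E \<in> carrier (Der K L)"
    using D E by (simp_all add: Der_def)
  have der: "x \<in> derivations K L \<longleftrightarrow> x \<in> carrier (Der K L)" for x
    by (simp add: Der_def)
  show "outer_class D \<oplus>\<^bsub>Out K L\<^esub> outer_class E = outer_class (D \<oplus>\<^bsub>Der K L\<^esub> E)"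
    by (simp add: Out_def lie_quotient_def S.a_rcos_sum)
  have self: "D \<in> outer_class D" "E \<in> outer_class E"
    by (auto intro: S.a_rcos_self)
  have elem: "\<exists>i\<in>?I. y = i \<oplus>\<^bsub>Der K L\<^esub> x" if "y \<in> outer_class x" for x y
    using that by (auto simp: a_r_coset_def')
  have elemI: "i \<oplus>\<^bsub>Der K L\<^esub> x \<in> outer_class x" if "i \<in> ?I" for x i
    using that by (auto simp: a_r_coset_def')
  show "c \<odot>\<^bsub>Out K L\<^esub> outer_class D = outer_class (c \<odot>\<^bsub>Der K L\<^esub> D)" if c: "c \<in> carrier K"
  proof -
    have "outer_class (c \<odot>\<^bsub>Der K L\<^esub> x) = outer_class (c \<odot>\<^bsub>Der K L\<^esub> D)" if x: "x \<in> outer_class D" for x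
    proof (rule outer_class_cong)
      show "c \<odot>\<^bsub>Der K L\<^esub> D \<in> derivations K L"
        using c by (simp add: der)
      obtain i where i: "i \<in> ?I" "x = i \<oplus>\<^bsub>Der K L\<^esub> D"
        using elem[OF x] by blast
      then obtain z where z: "z \<in> carrier L" "i = restrict (bracket L z) (carrier L)"
        by (auto simp: inner_derivations_def)
      have "c \<odot>\<^bsub>Der K L\<^esub> i = restrict (bracket L (c \<odot> z)) (carrier L)"
        using c z by (auto simp: Der_def bracket_smult_left intro!: restrict_eqI)
      then have "c \<odot>\<^bsub>Der K L\<^esub> i \<in> ?I"
        using c z by (auto simp: inner_derivations_def)
      moreover have "c \<odot>\<^bsub>Der K L\<^esub> x = c \<odot>\<^bsub>Der K L\<^esub> i \<oplus>\<^bsub>Der K L\<^esub> c \<odot>\<^bsub>Der K L\<^esub> D"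
        using c i by (simp add: D.smult_r_distr)
      ultimately show "c \<odot>\<^bsub>Der K L\<^esub> x \<in> outer_class (c \<odot>\<^bsub>Der K L\<^esub> D)"
        by (simp add: elemI)
    qed
    then have "(\<Union>x\<in>outer_class D. outer_class (c \<odot>\<^bsub>Der K L\<^esub> x)) = outer_class (c \<odot>\<^bsub>Der K L\<^esub> D)"
      using self by blast
    then show ?thesis
      by (simp add: Out_def lie_quotient_def)
  qed
  show "bracket (Out K L) (outer_class D) (outer_class E) = outer_class (bracket (Der K L) D E)"
  proof -
    have "outer_class (bracket (Der K L) x y) = outer_class (bracket (Der K L) D E)"
      if x: "x \<in> outer_class D" and y: "y \<in> outer_class E" for x y
    proof (rule outer_class_cong)
      show "bracket (Der K L) D E \<in> derivations K L"
        by (simp add: der D.bracket_closed)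
      obtain i where i: "i \<in> ?I" "x = i \<oplus>\<^bsub>Der K L\<^esub> D"
        using elem[OF x] by blast
      obtain j where j: "j \<in> ?I" "y = j \<oplus>\<^bsub>Der K L\<^esub> E"
        using elem[OF y] by blast
      have [simp]: "i \<in> carrier (Der K L)" "j \<in> carrier (Der K L)"
        using i j by auto
      \<comment> \<open>Changing the representatives \<open>D\<close> and \<open>E\<close> by inner
        \<open>i\<close> and \<open>j\<close> changes their bracket by these three terms, each of
        which has an inner factor.\<close>
      let ?k = "bracket (Der K L) i j \<oplus>\<^bsub>Der K L\<^esub> bracket (Der K L) i E \<oplus>\<^bsub>Der K L\<^esub> bracket (Der K L) D j"
      have "?k \<in> ?I"
        using i j D E by (intro S.a_closed Der_bracket_inner) (simp_all add: der)
      moreover have "bracket (Der K L) x y = ?k \<oplus>\<^bsub>Der K L\<^esub> bracket (Der K L) D E"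
        using i j by (simp add: D.bracket_add_left D.bracket_add_right D.bracket_closed D.a_ac)
      ultimately show "bracket (Der K L) x y \<in> outer_class (bracket (Der K L) D E)"
        by (simp add: elemI)
    qed
    then have "(\<Union>x\<in>outer_class D. \<Union>y\<in>outer_class E. outer_class (bracket (Der K L) x y)) = outer_class (bracket (Der K L) D E)"
      using self by blast
    then show ?thesis
      by (simp add: Out_def lie_quotient_def)
  qed
qed

text \<open>\<open>derived_series\<close> is built from spans, and the facts about spans become
  available for \<open>Out K L\<close> once it is a module.\<close>

lemma Out_module: "Module.module K (Out K L)"
proof -
  interpret D: lie_algebra K "Der K L" by (rule Der_lie_algebra)
  have der: "derivations K L = carrier (Der K L)"
    by (simp add: Der_def)
  note [simp] = Out_operations[unfolded der] Out_zero
  show ?thesis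
  proof (rule module_criteria, goal_cases)
    case 1
    show ?case by unfold_locales
  next
    case 4
    have "outer_class D \<oplus>\<^bsub>Out K L\<^esub> outer_class (\<ominus>\<^bsub>Der K L\<^esub> D) = \<zero>\<^bsub>Out K L\<^esub>"
      if "D \<in> carrier (Der K L)" for D
      using that by (simp add: D.r_neg)
    then show ?case by (auto simp: Out_carrier der)
  next
    case 6
    have "outer_class D \<oplus>\<^bsub>Out K L\<^esub> outer_class E = outer_class E \<oplus>\<^bsub>Out K L\<^esub> outer_class D"
      if "D \<in> carrier (Der K L)" "E \<in> carrier (Der K L)" for D E
      using that D.a_comm[OF that] by simp
    then show ?case by (auto simp only: Out_carrier der)
  qed (auto simp: Out_carrier der D.a_assoc D.smult_assoc1 D.smult_l_distr D.smult_r_distr)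
qed

text \<open>Each of the three elements is a bracket of two of them, so their classes survive in
  every term of the derived series. If some term were zero, the class of \<open>D\<close> would be
  zero and \<open>D\<close> inner.\<close>

lemma not_solvable_Out:
  assumes D: "D \<in> derivations K L" "E \<in> derivations K L" "F \<in> derivations K L"
    and brackets: "bracket (Der K L) D E = F" "bracket (Der K L) D F = D" "bracket (Der K L) F E = E"
    and outer: "D \<notin> inner_derivations L"
  shows "\<not> solvable_lie K (Out K L)"
proof -
  interpret O: Module.module K "Out K L" by (rule Out_module)
  interpret S: abelian_subgroup "inner_derivations L" "Der K L"
    by (rule inner_derivations_abelian_subgroup)
  let ?X = "{outer_class D, outer_class E, outer_class F}"
  \<comment> \<open>The second inclusion is carried along because the span facts apply to sets of
    brackets inside the carrier.\<close>
  have X: "?X \<subseteq> derived_series K (Out K L) k" "derived_series K (Out K L) k \<subseteq> carrier (Out K L)" for k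
  proof (induction k)
    case 0
    show "?X \<subseteq> derived_series K (Out K L) 0" "derived_series K (Out K L) 0 \<subseteq> carrier (Out K L)"
      using D by (auto simp: Out_carrier)
  next
    case (Suc k)
    let ?S = "derived_series K (Out K L) k"
    let ?B = "{bracket (Out K L) x y | x y. x \<in> ?S \<and> y \<in> ?S}"
    have "bracket (Der K L) D' E' \<in> derivations K L"
      if "D' \<in> derivations K L" "E' \<in> derivations K L" for D' E'
      using commutator_derivation[OF that] by (simp add: Der_def)
    then have "bracket (Out K L) x y \<in> carrier (Out K L)"
      if "x \<in> carrier (Out K L)" "y \<in> carrier (Out K L)" for x y
      using that by (auto simp: Out_carrier Out_bracket)
    then have B: "?B \<subseteq> carrier (Out K L)"
      using Suc.IH(2) by blast
    then show "derived_series K (Out K L) (Suc k) \<subseteq> carrier (Out K L)"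
      using O.span_is_subset2 by simp
    have "outer_class F = bracket (Out K L) (outer_class D) (outer_class E)"
      by (simp only: Out_bracket D brackets)
    moreover have "outer_class D = bracket (Out K L) (outer_class D) (outer_class F)"
      by (simp only: Out_bracket D brackets)
    moreover have "outer_class E = bracket (Out K L) (outer_class F) (outer_class E)"
      by (simp only: Out_bracket D brackets)
    ultimately have "?X \<subseteq> ?B"
      using Suc.IH(1) by blast
    then show "?X \<subseteq> derived_series K (Out K L) (Suc k)"
      using O.in_own_span[OF B] by auto
  qed
  have "D \<in> outer_class D"
    using D by (intro S.a_rcos_self) (simp add: Der_def)
  moreover have "outer_class D = inner_derivations L" if "derived_series K (Out K L) k = {\<zero>\<^bsub>Out K L\<^esub>}" for k
    using X(1)[of k] that by (simp add: Out_def lie_quotient_def)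
  ultimately show ?thesis
    using outer by (auto simp: solvable_lie_def)
qed

end

section \<open>Divided power algebras as vector spaces\<close>

lemma divided_power_algebra_simps [simp]:
  fixes f g :: "'a::field dpoly"
  shows "carrier (divided_power_algebra m n) = {f :: 'a dpoly. \<forall>a. a \<notin> multi_indices CHAR('a) m n \<longrightarrow> f a = 0}"
  "\<zero>\<^bsub>divided_power_algebra m n\<^esub> = (\<lambda>_. 0 :: 'a)"
  "f \<oplus>\<^bsub>divided_power_algebra m n\<^esub> g = (\<lambda>a. f a + g a)"
  "c \<odot>\<^bsub>divided_power_algebra m n\<^esub> f = (\<lambda>a. c * f a)"
  by (simp_all add: divided_power_algebra_def Let_def)

lemma divided_power_algebra_module:
  "Module.module class_ring (divided_power_algebra m n :: ('a::field, 'a dpoly) module)"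
proof (rule module_criteria, goal_cases)
  case 4
  have "\<exists>g\<in>carrier (divided_power_algebra m n). f \<oplus>\<^bsub>divided_power_algebra m n\<^esub> g = \<zero>\<^bsub>divided_power_algebra m n\<^esub>"
    if "f \<in> carrier (divided_power_algebra m n)" for f :: "'a dpoly"
    using that by (intro bexI[of _ "\<lambda>a. - f a"]) simp_all
  then show ?case by blast
qed (auto simp: class_cring.is_cring fun_eq_iff algebra_simps)

lemma divided_power_algebra_minus:
  fixes f g :: "'a::field dpoly"
  assumes "f \<in> carrier (divided_power_algebra m n)" "g \<in> carrier (divided_power_algebra m n)"
  shows "f \<ominus>\<^bsub>divided_power_algebra m n\<^esub> g = (\<lambda>a. f a - g a)"
proof -
  interpret Module.module class_ring "divided_power_algebra m n :: ('a, 'a dpoly) module"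
    by (rule divided_power_algebra_module)
  have "\<ominus>\<^bsub>divided_power_algebra m n\<^esub> g = (\<lambda>a. - g a)"
    using assms by (intro M.minus_equality) auto
  then show ?thesis by (simp add: M.minus_eq)
qed

text \<open>\<open>f\<close> and \<open>g\<close> range over all coefficient functions, since the
  product reads coefficients at multi-indices only and is cut off outside them.\<close>

lemma dp_mult_linear:
  fixes f g :: "'a::field dpoly" and m n
  defines "A \<equiv> (divided_power_algebra m n :: ('a, 'a dpoly) module)"
  shows "(\<lambda>a. f a + f' a) \<otimes>\<^bsub>A\<^esub> g = (\<lambda>a. (f \<otimes>\<^bsub>A\<^esub> g) a + (f' \<otimes>\<^bsub>A\<^esub> g) a)"
    and "f \<otimes>\<^bsub>A\<^esub> (\<lambda>a. g a + g' a) = (\<lambda>a. (f \<otimes>\<^bsub>A\<^esub> g) a + (f \<otimes>\<^bsub>A\<^esub> g') a)"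
    and "(\<lambda>a. c * f a) \<otimes>\<^bsub>A\<^esub> g = (\<lambda>a. c * (f \<otimes>\<^bsub>A\<^esub> g) a)"
    and "f \<otimes>\<^bsub>A\<^esub> (\<lambda>a. c * g a) = (\<lambda>a. c * (f \<otimes>\<^bsub>A\<^esub> g) a)"
    and "(\<lambda>a. 0) \<otimes>\<^bsub>A\<^esub> g = (\<lambda>a. 0)"
    and "f \<otimes>\<^bsub>A\<^esub> g \<in> carrier A"
proof -
  have mult: "(f \<otimes>\<^bsub>A\<^esub> g) c = (if c \<in> multi_indices CHAR('a) m n
      then \<Sum>x \<in> {(a, b). a \<in> multi_indices CHAR('a) m n \<and> b \<in> multi_indices CHAR('a) m n \<and> (\<lambda>i. a i + b i) = c}.
        f (fst x) * g (snd x) * of_nat (\<Prod>i\<in>{1..m}. (fst x i + snd x i) choose snd x i) else 0)"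
    for f g :: "'a dpoly" and c
    by (simp add: A_def divided_power_algebra_def Let_def case_prod_unfold)
  show "(\<lambda>a. f a + f' a) \<otimes>\<^bsub>A\<^esub> g = (\<lambda>a. (f \<otimes>\<^bsub>A\<^esub> g) a + (f' \<otimes>\<^bsub>A\<^esub> g) a)"
    by (rule ext) (simp add: mult distrib_right sum.distrib)
  show "f \<otimes>\<^bsub>A\<^esub> (\<lambda>a. g a + g' a) = (\<lambda>a. (f \<otimes>\<^bsub>A\<^esub> g) a + (f \<otimes>\<^bsub>A\<^esub> g') a)"
    by (rule ext) (simp add: mult distrib_right distrib_left sum.distrib)
  show "(\<lambda>a. c * f a) \<otimes>\<^bsub>A\<^esub> g = (\<lambda>a. c * (f \<otimes>\<^bsub>A\<^esub> g) a)"
    by (rule ext) (simp add: mult sum_distrib_left mult.assoc)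
  show "f \<otimes>\<^bsub>A\<^esub> (\<lambda>a. c * g a) = (\<lambda>a. c * (f \<otimes>\<^bsub>A\<^esub> g) a)"
    by (rule ext) (simp add: mult sum_distrib_left mult.assoc mult.left_commute)
  show "(\<lambda>a. 0) \<otimes>\<^bsub>A\<^esub> g = (\<lambda>a. 0)"
    by (rule ext) (simp add: mult)
  show "f \<otimes>\<^bsub>A\<^esub> g \<in> carrier A"
    unfolding A_def by (simp add: mult[unfolded A_def])
qed

lemma dp_partial_linear:
  "dp_partial i (\<lambda>a. f a + g a) = (\<lambda>a. dp_partial i f a + dp_partial i g a)"
  "dp_partial i (\<lambda>a. c * f a) = (\<lambda>a. c * dp_partial i f a)"
  by (simp_all add: dp_partial_def)

text \<open>The span in \<open>hamiltonian_algebra\<close> is formed inside this algebra, which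
  therefore has to be a vector space. Sums and multiples of operators come from sums and multiples
  of the coefficient families \<open>F\<close>.\<close>

lemma jacobson_witt_module:
  "Module.module class_ring (jacobson_witt_algebra m n :: ('a::field, 'a dpoly \<Rightarrow> 'a dpoly) lie_algebra)"
proof -
  define A where "A = (divided_power_algebra m n :: ('a, 'a dpoly) module)"
  interpret Module.module class_ring A
    unfolding A_def by (rule divided_power_algebra_module)
  note lin = dp_mult_linear[where ?'a = 'a and m = m and n = n, folded A_def]
  define V where "V F = restrict (\<lambda>g a. \<Sum>i\<in>{1..m}. (F i \<otimes>\<^bsub>A\<^esub> dp_partial i g) a) (carrier A)" for F
  define C where "C = {V F | F. \<forall>i\<in>{1..m}. F i \<in> carrier A}"
  have A_ops: "f \<oplus>\<^bsub>A\<^esub> g = (\<lambda>a. f a + g a)" "c \<odot>\<^bsub>A\<^esub> f = (\<lambda>a. c * f a)" "\<zero>\<^bsub>A\<^esub> = (\<lambda>_. 0)" for f g c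
    by (simp_all add: A_def)
  have sum_closed: "(\<lambda>a. \<Sum>i\<in>{1..m}. (F i \<otimes>\<^bsub>A\<^esub> dp_partial i g) a) \<in> carrier A" for F g
    using lin(6)[of "F _" "dp_partial _ g"] by (simp add: A_def)
  have "Module.module class_ring (operator_lie_algebra A C)"
  proof (rule operator_module)
    have "V F \<in> LinearCombinations.module_hom class_ring A A" for F
      unfolding LinearCombinations.module_hom_def
    proof (safe, goal_cases)
      case (1 g)
      then show ?case using sum_closed by (simp add: V_def)
    next
      case (2 g h)
      then show ?case
        using M.a_closed[OF 2]
        by (simp add: V_def A_ops dp_partial_linear lin sum.distrib)
    next
      case (3 c g)
      then show ?case
        using smult_closed[of c g]
        by (simp add: V_def A_ops dp_partial_linear lin sum_distrib_left)
    qed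
    then show "C \<subseteq> LinearCombinations.module_hom class_ring A A \<inter> extensional (carrier A)"
      by (auto simp: C_def V_def)
    show "restrict (\<lambda>x. \<zero>\<^bsub>A\<^esub>) (carrier A) \<in> C"
      unfolding C_def
      by (rule CollectI, rule exI[of _ "\<lambda>i a. 0"]) (use M.zero_closed in \<open>auto simp: V_def lin A_ops\<close>)
    show "restrict (\<lambda>x. D x \<oplus>\<^bsub>A\<^esub> E x) (carrier A) \<in> C" if D: "D \<in> C" and E: "E \<in> C" for D E
    proof -
      obtain F G where "D = V F" "\<forall>i\<in>{1..m}. F i \<in> carrier A" "E = V G" "\<forall>i\<in>{1..m}. G i \<in> carrier A"
        using D E by (auto simp: C_def)
      then show ?thesis
        unfolding C_def
        by (intro CollectI exI[of _ "\<lambda>i. F i \<oplus>\<^bsub>A\<^esub> G i"] conjI ballI M.a_closed)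
          (auto simp: V_def A_ops lin sum.distrib intro!: restrict_eqI)
    qed
    show "restrict (\<lambda>x. c \<odot>\<^bsub>A\<^esub> D x) (carrier A) \<in> C" if "c \<in> carrier class_ring" and D: "D \<in> C" for c D
    proof -
      obtain F where "D = V F" "\<forall>i\<in>{1..m}. F i \<in> carrier A"
        using D by (auto simp: C_def)
      then show ?thesis
        unfolding C_def
        by (intro CollectI exI[of _ "\<lambda>i. c \<odot>\<^bsub>A\<^esub> F i"] conjI ballI smult_closed)
          (auto simp: V_def A_ops lin sum_distrib_left intro!: restrict_eqI)
    qed
  qed
  then show ?thesis
    unfolding jacobson_witt_algebra_def Let_def C_def V_def A_def .
qed

section \<open>The divided power algebra O(2; (1, n)) in characteristic 3\<close>

definition bi_index :: "nat \<Rightarrow> nat \<Rightarrow> nat \<Rightarrow> nat" where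
  "bi_index i j = (\<lambda>k. if k = 1 then i else if k = 2 then j else 0)"

lemma bi_index_simps [simp]:
  "bi_index i j (Suc 0) = i" "bi_index i j 2 = j"
  "(bi_index i j)(Suc 0 := i') = bi_index i' j" "(bi_index i j)(2 := j') = bi_index i j'"
  by (simp_all add: bi_index_def fun_eq_iff)

lemma bi_index_inject [simp]: "bi_index i j = bi_index i' j' \<longleftrightarrow> i = i' \<and> j = j'"
  by (metis bi_index_simps(1,2))

locale hamiltonian_char_3 =
  fixes n :: nat and field_type :: "'a::field itself"
  assumes char_3: "CHAR('a) = 3" and n_pos: "n \<ge> 1"
begin

definition heights :: "nat \<Rightarrow> nat" where
  "heights = (\<lambda>i. if i = 1 then 1 else n)"

definition O_alg :: "('a, 'a dpoly) module" where
  "O_alg = divided_power_algebra 2 heights"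

abbreviation O_carrier :: "'a dpoly set" where
  "O_carrier \<equiv> carrier O_alg"

sublocale O: Module.module class_ring O_alg
  unfolding O_alg_def by (rule divided_power_algebra_module)

lemma O_alg_simps [simp]:
  "\<zero>\<^bsub>O_alg\<^esub> = (\<lambda>_. 0)" "f \<oplus>\<^bsub>O_alg\<^esub> g = (\<lambda>a. f a + g a)" "c \<odot>\<^bsub>O_alg\<^esub> f = (\<lambda>a. c * f a)"
  by (simp_all add: O_alg_def)

lemmas O_minus = divided_power_algebra_minus[where ?'a = 'a and m = 2 and n = heights, folded O_alg_def]

lemmas O_mult_linear = dp_mult_linear[where ?'a = 'a and m = 2 and n = heights, folded O_alg_def]

lemma three_eq_0: "(3 :: 'a) = 0"
  using of_nat_CHAR[where 'a = 'a] by (simp add: char_3)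

lemma power_3_n_ge: "3 ^ n \<ge> (3::nat)"
  using power_increasing[of 1 n "3::nat"] n_pos by simp

lemma multi_indices_eq: "multi_indices 3 2 heights = (\<lambda>(i, j). bi_index i j) ` ({..<3} \<times> {..<3 ^ n})"
proof
  show "multi_indices 3 2 heights \<subseteq> (\<lambda>(i, j). bi_index i j) ` ({..<3} \<times> {..<3 ^ n})"
  proof
    fix a assume a: "a \<in> multi_indices 3 2 heights"
    then have "a = bi_index (a 1) (a 2)"
      by (auto simp: multi_indices_def bi_index_def fun_eq_iff)
    moreover have "a 1 < 3 ^ heights 1" "a 2 < 3 ^ heights 2"
      using a by (simp_all add: multi_indices_def)
    then have "a 1 < 3" "a 2 < 3 ^ n"
      by (simp_all add: heights_def)
    ultimately show "a \<in> (\<lambda>(i, j). bi_index i j) ` ({..<3} \<times> {..<3 ^ n})"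
      by (intro image_eqI[of _ _ "(a 1, a 2)"]) auto
  qed
qed (auto simp: multi_indices_def bi_index_def heights_def)

lemma bi_index_in_multi_indices [simp]:
  "bi_index i j \<in> multi_indices 3 2 heights \<longleftrightarrow> i < 3 \<and> j < 3 ^ n"
  by (auto simp: multi_indices_eq)

lemma O_carrier_iff: "f \<in> O_carrier \<longleftrightarrow> (\<forall>a. a \<notin> multi_indices 3 2 heights \<longrightarrow> f a = 0)"
  by (simp add: O_alg_def char_3)

lemma O_carrier_bi_index: "f \<in> O_carrier \<Longrightarrow> \<not> (i < 3 \<and> j < 3 ^ n) \<Longrightarrow> f (bi_index i j) = 0"
  unfolding O_carrier_iff bi_index_in_multi_indices[symmetric] by blast

lemma O_eqI:
  assumes "f \<in> O_carrier" "g \<in> O_carrier"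
    and "\<And>i j. i < 3 \<Longrightarrow> j < 3 ^ n \<Longrightarrow> f (bi_index i j) = g (bi_index i j)"
  shows "f = g"
proof
  fix a show "f a = g a"
  proof (cases "a \<in> multi_indices 3 2 heights")
    case True
    then show ?thesis using assms(3) by (auto simp: multi_indices_eq)
  next
    case False
    then show ?thesis using assms(1,2) by (simp add: O_carrier_iff)
  qed
qed

section \<open>Elements of O(2; (1, n)) as triples of Hurwitz series\<close>

definition row :: "'a dpoly \<Rightarrow> nat \<Rightarrow> 'a hseries" where
  "row f i = Abs_hs (\<lambda>j. f (bi_index i j))"

definition truncated :: "'a hseries \<Rightarrow> bool" where
  "truncated h \<longleftrightarrow> (\<forall>k\<ge>3 ^ n. hs_nth h k = 0)"

lemma hs_nth_row [simp]: "hs_nth (row f i) j = f (bi_index i j)"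
  by (simp add: row_def)

lemma truncated_row: "f \<in> O_carrier \<Longrightarrow> truncated (row f i)"
  by (simp add: truncated_def O_carrier_bi_index)

text \<open>Closure under products is where characteristic 3 enters: a product of two divided powers
  below the bound may have an exponent beyond it, but then its binomial coefficient is divisible by
  3.\<close>

lemma truncated_simps:
  "truncated 0" "truncated f \<Longrightarrow> truncated g \<Longrightarrow> truncated (f + g)"
  "truncated f \<Longrightarrow> truncated g \<Longrightarrow> truncated (f - g)" "truncated f \<Longrightarrow> truncated (- f)"
  "truncated f \<Longrightarrow> truncated g \<Longrightarrow> truncated (f * g)"
  "truncated f \<Longrightarrow> truncated (hs_deriv f)"
  using hs_nth_mult_eq_0[OF three_eq_0, of n f g] by (auto simp: truncated_def)

lemma row_eqI:
  assumes "f \<in> O_carrier" "g \<in> O_carrier" "row f 0 = row g 0" "row f (Suc 0) = row g (Suc 0)" "row f 2 = row g 2"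
  shows "f = g"
proof (rule O_eqI[OF assms(1,2)])
  fix i j :: nat assume "i < 3"
  then have "i = 0 \<or> i = 1 \<or> i = 2" by auto
  then have "row f i = row g i" using assms(3-5) by auto
  then have "hs_nth (row f i) j = hs_nth (row g i) j" by simp
  then show "f (bi_index i j) = g (bi_index i j)" by simp
qed

definition of_rows :: "'a hseries \<Rightarrow> 'a hseries \<Rightarrow> 'a hseries \<Rightarrow> 'a dpoly" where
  "of_rows u v w = (\<lambda>a. if a \<in> multi_indices 3 2 heights
     then hs_nth (if a 1 = 0 then u else if a 1 = 1 then v else w) (a 2) else 0)"

lemma of_rows_carrier [simp]: "of_rows u v w \<in> O_carrier"
  unfolding O_carrier_iff by (simp add: of_rows_def)

lemma row_of_rows:
  assumes "truncated u" "truncated v" "truncated w"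
  shows "row (of_rows u v w) 0 = u" "row (of_rows u v w) (Suc 0) = v" "row (of_rows u v w) 2 = w"
  using assms by (auto simp: of_rows_def truncated_def intro!: hs_eqI)

lemma dp_mult_bi_index:
  assumes "i < 3" "j < 3 ^ n"
  shows "(f \<otimes>\<^bsub>O_alg\<^esub> g) (bi_index i j) =
    (\<Sum>k\<le>i. \<Sum>l\<le>j. of_nat (i choose k) * of_nat (j choose l) * f (bi_index k l) * g (bi_index (i - k) (j - l)))"
proof -
  let ?I = "multi_indices 3 2 heights"
  let ?S = "{(a, b). a \<in> ?I \<and> b \<in> ?I \<and> (\<lambda>i. a i + b i) = bi_index i j}"
  have split: "{Suc 0..2} = {Suc 0, 2}" by auto
  have "(f \<otimes>\<^bsub>O_alg\<^esub> g) (bi_index i j)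
      = (\<Sum>(a, b)\<in>?S. f a * g b * of_nat (\<Prod>i\<in>{1..2}. (a i + b i) choose b i))"
    using assms by (simp add: O_alg_def divided_power_algebra_def Let_def char_3 del: of_nat_prod)
  also have "\<dots> = (\<Sum>(k, l)\<in>{..i} \<times> {..j}.
      of_nat (i choose k) * of_nat (j choose l) * f (bi_index k l) * g (bi_index (i - k) (j - l)))"
  \<comment> \<open>A pair of multi-indices with sum (i, j) is determined by its first member, which
    gives the summation over \<open>k\<close> and \<open>l\<close>.\<close>
  proof (rule sum.reindex_bij_witness[of _ "\<lambda>(k, l). (bi_index k l, bi_index (i - k) (j - l))"
        "\<lambda>(a, b). (a 1, a 2)"], goal_cases)
    case (1 x)
    then obtain k l k' l' where x: "x = (bi_index k l, bi_index k' l')"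
        "(\<lambda>m. bi_index k l m + bi_index k' l' m) = bi_index i j"
      by (auto simp: multi_indices_eq)
    with fun_cong[OF x(2), of 1] fun_cong[OF x(2), of 2] show ?case by auto
  next
    case (2 x)
    then obtain k l k' l' where x: "x = (bi_index k l, bi_index k' l')"
        "(\<lambda>m. bi_index k l m + bi_index k' l' m) = bi_index i j"
      by (auto simp: multi_indices_eq)
    with fun_cong[OF x(2), of 1] fun_cong[OF x(2), of 2] show ?case by auto
  next
    case (3 x)
    then show ?case by auto
  next
    case (4 x)
    then show ?case using assms by (auto simp: fun_eq_iff) (auto simp: bi_index_def)
  next
    case (5 x)
    then obtain k l k' l' where x: "x = (bi_index k l, bi_index k' l')"
        "(\<lambda>m. bi_index k l m + bi_index k' l' m) = bi_index i j"
      by (auto simp: multi_indices_eq)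
    with fun_cong[OF x(2), of 1] fun_cong[OF x(2), of 2] have "i = k + k'" "j = l + l'" by auto
    then show ?case
      \<comment> \<open>The product of the divided power algebra chooses the index of the second
        factor, the convolution that of the first.\<close>
      using binomial_symmetric[of k "k + k'"] binomial_symmetric[of l "l + l'"]
      by (simp add: x(1) split algebra_simps)
  qed
  finally show ?thesis by (simp add: sum.cartesian_product)
qed

text \<open>For exponents of y beyond the bound the left side is zero by definition, and the right
  side because truncated series are closed under products. So rows can be multiplied as if y were
  unbounded.\<close>

lemma dp_mult_eq_hs_nth:
  assumes f: "f \<in> O_carrier" and g: "g \<in> O_carrier" and i: "i < 3"
  shows "(f \<otimes>\<^bsub>O_alg\<^esub> g) (bi_index i j) = (\<Sum>k\<le>i. of_nat (i choose k) * hs_nth (row f k * row g (i - k)) j)"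
proof (cases "j < 3 ^ n")
  case True
  have "hs_nth (row f k * row g l) j
      = (\<Sum>m\<le>j. of_nat (j choose m) * f (bi_index k m) * g (bi_index l (j - m)))" for k l
    by (simp add: hs_nth_mult)
  then show ?thesis
    by (simp only: dp_mult_bi_index[OF i True] sum_distrib_left mult.assoc)
next
  case False
  have "truncated (row f k * row g l)" for k l
    using f g by (intro truncated_simps truncated_row)
  then have "hs_nth (row f k * row g l) j = 0" for k l
    using False by (simp add: truncated_def)
  moreover have "(f \<otimes>\<^bsub>O_alg\<^esub> g) (bi_index i j) = 0"
    using False by (intro O_carrier_bi_index O_mult_linear(6)) simp
  ultimately show ?thesis by simp
qed

lemma row_mult:
  assumes f: "f \<in> O_carrier" and g: "g \<in> O_carrier"
  shows "row (f \<otimes>\<^bsub>O_alg\<^esub> g) 0 = row f 0 * row g 0"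
    and "row (f \<otimes>\<^bsub>O_alg\<^esub> g) (Suc 0) = row f 0 * row g (Suc 0) + row f (Suc 0) * row g 0"
    and "row (f \<otimes>\<^bsub>O_alg\<^esub> g) 2 = row f 0 * row g 2 + 2 * (row f (Suc 0) * row g (Suc 0)) + row f 2 * row g 0"
proof -
  note key = dp_mult_eq_hs_nth[OF f g]
  show "row (f \<otimes>\<^bsub>O_alg\<^esub> g) 0 = row f 0 * row g 0"
    by (rule hs_eqI) (simp add: key)
  show "row (f \<otimes>\<^bsub>O_alg\<^esub> g) (Suc 0) = row f 0 * row g (Suc 0) + row f (Suc 0) * row g 0"
    by (rule hs_eqI) (simp add: key)
  have "hs_nth (2 * h) j = 2 * hs_nth h j" for h :: "'a hseries" and j
    by (simp only: mult_2 hs_nth_simps)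
  then show "row (f \<otimes>\<^bsub>O_alg\<^esub> g) 2 = row f 0 * row g 2 + 2 * (row f (Suc 0) * row g (Suc 0)) + row f 2 * row g 0"
    by (intro hs_eqI) (simp add: key numeral_2_eq_2)
qed

lemma row_linear [simp]:
  "row (\<lambda>a. f a + g a) i = row f i + row g i" "row (\<lambda>a. f a - g a) i = row f i - row g i"
  "row (\<lambda>a. 0) i = 0"
  by (auto intro!: hs_eqI)

lemma two_hs_eq: "(2 :: 'a hseries) = - 1"
  using three_hs_eq_0[OF three_eq_0] by (simp add: eq_neg_iff_add_eq_0)

lemma row_partial_1: "row (dp_partial (Suc 0) f) i = row f (Suc i)"
  by (rule hs_eqI) (simp add: dp_partial_def)

lemma row_partial_2: "row (dp_partial 2 f) i = hs_deriv (row f i)"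
  by (rule hs_eqI) (simp add: dp_partial_def)

lemma row_3: "f \<in> O_carrier \<Longrightarrow> row f 3 = 0"
  by (rule hs_eqI) (simp add: O_carrier_bi_index)

text \<open>Multi-indices are closed under lowering a coordinate, so raising one cannot bring an
  outside index in.\<close>

lemma dp_partial_carrier:
  assumes "f \<in> O_carrier" "i = Suc 0 \<or> i = 2"
  shows "dp_partial i f \<in> O_carrier"
  unfolding O_carrier_iff
proof (intro allI impI)
  fix a assume a: "a \<notin> multi_indices 3 2 heights"
  have "a(i := a i + 1) \<notin> multi_indices 3 2 heights"
  proof
    assume *: "a(i := a i + 1) \<in> multi_indices 3 2 heights"
    then have "a k < 3 ^ heights k" if "k \<in> {1..2}" for k
      using that by (auto simp: multi_indices_def dest!: bspec[of _ _ k] split: if_splits)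
    moreover have "a k = 0" if "k \<notin> {1..2}" for k
      using that * assms(2) by (auto simp: multi_indices_def dest!: spec[of _ k] split: if_splits)
    ultimately show False using a by (auto simp: multi_indices_def)
  qed
  then show "dp_partial i f a = 0"
    using assms(1) unfolding O_carrier_iff by (simp add: dp_partial_def)
qed

section \<open>The Poisson bracket f_x g_y - f_y g_x in terms of rows\<close>

definition ham :: "'a dpoly \<Rightarrow> 'a dpoly \<Rightarrow> 'a dpoly" where
  "ham = D_H 1 heights"

lemma ham_eq:
  assumes "g \<in> O_carrier"
  shows "ham f g = (\<lambda>a. (dp_partial (Suc 0) f \<otimes>\<^bsub>O_alg\<^esub> dp_partial 2 g) a - (dp_partial 2 f \<otimes>\<^bsub>O_alg\<^esub> dp_partial (Suc 0) g) a)"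
proof -
  have "{Suc 0..2} = {Suc 0, 2}" by auto
  then show ?thesis
    using assms by (simp add: ham_def D_H_def O_alg_def Let_def ham_sign_def ham_conj_def flip: numeral_2_eq_2)
qed

lemma ham_extensional: "ham f \<in> extensional O_carrier"
  by (simp add: ham_def D_H_def O_alg_def Let_def)

lemma ham_eqI: "(\<And>g. g \<in> O_carrier \<Longrightarrow> ham f g = ham f' g) \<Longrightarrow> ham f = ham f'"
  by (rule extensionalityI[OF ham_extensional ham_extensional])

lemma ham_closed:
  assumes "g \<in> O_carrier"
  shows "ham f g \<in> O_carrier"
  using O.M.minus_closed[OF O_mult_linear(6) O_mult_linear(6)]
  by (simp add: ham_eq[OF assms] O_minus O_mult_linear(6))

text \<open>In row 2 the middle terms of the products carry the factor 2, which is -1 here. This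
  turns the row into a total derivative, on which both \<open>ham_O_top\<close> and the symmetry
  under sl_2 rest.\<close>

lemma row_ham:
  assumes f: "f \<in> O_carrier" and g: "g \<in> O_carrier"
  shows "row (ham f g) 0 = row f (Suc 0) * hs_deriv (row g 0) - hs_deriv (row f 0) * row g (Suc 0)"
    and "row (ham f g) (Suc 0) = row f (Suc 0) * hs_deriv (row g (Suc 0)) + row f 2 * hs_deriv (row g 0)
      - hs_deriv (row f 0) * row g 2 - hs_deriv (row f (Suc 0)) * row g (Suc 0)"
    and "row (ham f g) 2 = hs_deriv (row f (Suc 0) * row g 2 - row f 2 * row g (Suc 0))"
proof -
  note mult = row_mult[OF dp_partial_carrier dp_partial_carrier, OF f _ g]
  note part = row_partial_1 row_partial_2
  have [simp]: "row f 3 = 0" "row g 3 = 0"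
    using f g by (simp_all add: row_3)
  show "row (ham f g) 0 = row f (Suc 0) * hs_deriv (row g 0) - hs_deriv (row f 0) * row g (Suc 0)"
    by (simp add: ham_eq[OF g] mult(1) f g part)
  show "row (ham f g) (Suc 0) = row f (Suc 0) * hs_deriv (row g (Suc 0)) + row f 2 * hs_deriv (row g 0)
      - hs_deriv (row f 0) * row g 2 - hs_deriv (row f (Suc 0)) * row g (Suc 0)"
    by (simp add: ham_eq[OF g] mult(2) part algebra_simps flip: numeral_2_eq_2)
  show "row (ham f g) 2 = hs_deriv (row f (Suc 0) * row g 2 - row f 2 * row g (Suc 0))"
    by (simp add: ham_eq[OF g] mult(3) part two_hs_eq algebra_simps flip: numeral_2_eq_2)
qed

text \<open>This is the Jacobi identity of the Poisson bracket. By the row formulas it reduces, row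
  by row, to an identity in a commutative ring with a derivation.\<close>

lemma ham_commutator:
  assumes "f \<in> O_carrier" "g \<in> O_carrier" "h \<in> O_carrier"
  shows "ham (ham f g) h = (\<lambda>a. ham f (ham g h) a - ham g (ham f h) a)"
proof (rule row_eqI)
  note [simp] = row_ham ham_closed assms
  have closed: "ham f (ham g h) \<in> O_carrier" "ham g (ham f h) \<in> O_carrier" by simp_all
  show "(\<lambda>a. ham f (ham g h) a - ham g (ham f h) a) \<in> O_carrier"
    using O.M.minus_closed[OF closed] by (simp add: O_minus[OF closed])
  show "row (ham (ham f g) h) 0 = row (\<lambda>a. ham f (ham g h) a - ham g (ham f h) a) 0"
    by (simp add: row_ham algebra_simps)
  show "row (ham (ham f g) h) (Suc 0) = row (\<lambda>a. ham f (ham g h) a - ham g (ham f h) a) (Suc 0)"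
    \<comment> \<open>The terms left over in this row disappear with \<open>3 = 0\<close>.\<close>
    by (simp add: row_ham algebra_simps) (simp add: three_hs_eq_0[OF three_eq_0])
  show "row (ham (ham f g) h) 2 = row (\<lambda>a. ham f (ham g h) a - ham g (ham f h) a) 2"
    by (simp add: row_ham algebra_simps)
qed (use assms ham_closed in blast)

end

section \<open>The Hamiltonian algebra\<close>

context hamiltonian_char_3
begin

lemma ham_add:
  "h \<in> O_carrier \<Longrightarrow> ham (\<lambda>a. f a + g a) h = (\<lambda>a. ham f h a + ham g h a)"
  by (simp add: ham_eq dp_partial_linear O_mult_linear algebra_simps)

lemma ham_smult:
  "h \<in> O_carrier \<Longrightarrow> ham (\<lambda>a. c * f a) h = (\<lambda>a. c * ham f h a)"
  by (simp add: ham_eq dp_partial_linear O_mult_linear algebra_simps)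

lemma ham_zero: "h \<in> O_carrier \<Longrightarrow> ham (\<lambda>a. 0) h = (\<lambda>a. 0)"
  using ham_smult[of h 0 "\<lambda>a. 0"] by simp

lemma ham_module_hom: "ham f \<in> LinearCombinations.module_hom class_ring O_alg O_alg"
  unfolding LinearCombinations.module_hom_def
proof (safe, goal_cases)
  case (1 h)
  then show ?case by (rule ham_closed)
next
  case (2 g h)
  then show ?case
    using O.M.a_closed[OF 2] by (simp add: ham_eq dp_partial_linear O_mult_linear algebra_simps)
next
  case (3 c g)
  then show ?case
    using O.smult_closed[of c g] by (simp add: ham_eq dp_partial_linear O_mult_linear algebra_simps)
qed

lemma bi_index_0_0: "bi_index 0 0 = (\<lambda>_. 0)"
  by (auto simp: bi_index_def)

lemma row_dp_monomial:
  "hs_nth (row (dp_monomial (bi_index i j)) k) l = (if k = i \<and> l = j then 1 else 0)"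
  by (simp add: dp_monomial_def)

lemma dp_monomial_carrier: "i < 3 \<Longrightarrow> j < 3 ^ n \<Longrightarrow> dp_monomial (bi_index i j) \<in> O_carrier"
  unfolding O_carrier_iff by (auto simp: dp_monomial_def)

abbreviation X :: "'a dpoly" where "X \<equiv> dp_monomial (bi_index (Suc 0) 0)"
abbreviation Y :: "'a dpoly" where "Y \<equiv> dp_monomial (bi_index 0 (Suc 0))"

lemma XY_rows [simp]:
  "X \<in> O_carrier" "Y \<in> O_carrier" "row X 0 = 0" "row X (Suc 0) = 1" "row X 2 = 0"
  "hs_deriv (row Y 0) = 1" "row Y (Suc 0) = 0" "row Y 2 = 0"
  using power_3_n_ge by (auto intro!: dp_monomial_carrier hs_eqI simp: row_dp_monomial hs_nth_1 simp del: hs_nth_row)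

lemma hs_deriv_1 [simp]: "hs_deriv (1 :: 'a hseries) = 0"
  by (rule hs_eqI) (simp add: hs_nth_1)

text \<open>The operator can be read off from two values: at \<open>Y\<close> its rows 0 and 1 are
  rows 1 and 2 of \<open>f\<close>, and at \<open>X\<close> its row 0 is minus the derivative of row
  0 of \<open>f\<close>.\<close>

lemma ham_eq_iff_rows:
  assumes f: "f \<in> O_carrier" and g: "g \<in> O_carrier"
  shows "ham f = ham g \<longleftrightarrow>
    hs_deriv (row f 0) = hs_deriv (row g 0) \<and> row f (Suc 0) = row g (Suc 0) \<and> row f 2 = row g 2"
proof
  assume eq: "ham f = ham g"
  have "row (ham f Y) 0 = row (ham g Y) 0" "row (ham f Y) (Suc 0) = row (ham g Y) (Suc 0)"
    "row (ham f X) 0 = row (ham g X) 0"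
    by (simp_all only: eq)
  then show "hs_deriv (row f 0) = hs_deriv (row g 0) \<and> row f (Suc 0) = row g (Suc 0) \<and> row f 2 = row g 2"
    by (simp add: row_ham f g)
next
  assume "hs_deriv (row f 0) = hs_deriv (row g 0) \<and> row f (Suc 0) = row g (Suc 0) \<and> row f 2 = row g 2"
  then show "ham f = ham g"
    by (intro ham_eqI row_eqI ham_closed) (simp_all add: row_ham f g)
qed

text \<open>The kernel of \<open>ham\<close> consists of the constants, because
  \<open>hs_deriv\<close> forgets exactly the coefficient of index zero.\<close>

lemma ham_eq_iff:
  assumes f: "f \<in> O_carrier" and g: "g \<in> O_carrier"
  shows "ham f = ham g \<longleftrightarrow> (\<forall>a. a \<noteq> (\<lambda>_. 0) \<longrightarrow> f a = g a)"
proof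
  assume "ham f = ham g"
  then have rows: "hs_deriv (row f 0) = hs_deriv (row g 0)" "row f (Suc 0) = row g (Suc 0)" "row f 2 = row g 2"
    using ham_eq_iff_rows[OF f g] by auto
  have "f (bi_index i j) = g (bi_index i j)" if "i < 3" "(i, j) \<noteq> (0, 0)" for i j
  proof -
    have "i = 0 \<or> i = Suc 0 \<or> i = 2"
      using \<open>i < 3\<close> by auto
    then consider "i = 0" "j \<noteq> 0" | "i = Suc 0" | "i = 2"
      using \<open>(i, j) \<noteq> (0, 0)\<close> by auto
    then show ?thesis
    proof cases
      case 1
      then obtain k where "j = Suc k" by (cases j) auto
      then show ?thesis
        using arg_cong[OF rows(1), of "\<lambda>h. hs_nth h k"] 1 by simp
    next
      case 2
      then show ?thesis using arg_cong[OF rows(2), of "\<lambda>h. hs_nth h j"] by simp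
    next
      case 3
      then show ?thesis using arg_cong[OF rows(3), of "\<lambda>h. hs_nth h j"] by simp
    qed
  qed
  note coeff = this
  show "\<forall>a. a \<noteq> (\<lambda>_. 0) \<longrightarrow> f a = g a"
  proof (intro allI impI)
    fix a :: "nat \<Rightarrow> nat" assume a: "a \<noteq> (\<lambda>_. 0)"
    show "f a = g a"
    proof (cases "a \<in> multi_indices 3 2 heights")
      case True
      then obtain i j where ij: "a = bi_index i j" "i < 3" by (auto simp: multi_indices_eq)
      moreover from this have "(i, j) \<noteq> (0, 0)" using a bi_index_0_0 by auto
      ultimately show ?thesis using coeff[of i j] by simp
    next
      case False
      then show ?thesis using f g by (simp add: O_carrier_iff)
    qed
  qed
next
  assume "\<forall>a. a \<noteq> (\<lambda>_. 0) \<longrightarrow> f a = g a"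
  then have "f (bi_index i j) = g (bi_index i j)" if "i \<noteq> 0 \<or> j \<noteq> 0" for i j
    using that by (simp flip: bi_index_0_0)
  then show "ham f = ham g"
    unfolding ham_eq_iff_rows[OF f g] by (auto intro!: hs_eqI)
qed

definition top :: "nat \<Rightarrow> nat" where
  "top = bi_index 2 (3 ^ n - 1)"

text \<open>The generators of the Hamiltonian algebra, up to constants, which \<open>D_H\<close> annihilates.\<close>

definition O_top :: "'a dpoly set" where
  "O_top = {f \<in> O_carrier. f top = 0}"

lemma O_topD: "f \<in> O_top \<Longrightarrow> f \<in> O_carrier" "f \<in> O_top \<Longrightarrow> f top = 0"
  by (simp_all add: O_top_def)

text \<open>The top coefficient sits at \<open>3 ^ n - 1\<close> in row 2. As that row is a
  derivative, it equals coefficient \<open>3 ^ n\<close> of a truncated series.\<close>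

lemma ham_O_top:
  assumes "f \<in> O_carrier" "g \<in> O_carrier"
  shows "ham f g \<in> O_top"
proof -
  have "truncated (row f (Suc 0) * row g 2 - row f 2 * row g (Suc 0))"
    using assms by (intro truncated_simps truncated_row)
  then have "hs_nth (row (ham f g) 2) (3 ^ n - 1) = 0"
    unfolding row_ham(3)[OF assms] truncated_def hs_nth_deriv by simp
  then show ?thesis
    by (simp add: O_top_def top_def ham_closed assms)
qed

section \<open>The span of the Hamiltonian operators of monomials\<close>

definition basis_indices :: "(nat \<Rightarrow> nat) set" where
  "basis_indices = multi_indices 3 2 heights - {\<lambda>_. 0, top}"

definition W :: "('a, 'a dpoly \<Rightarrow> 'a dpoly) lie_algebra" where
  "W = jacobson_witt_algebra 2 heights"

definition ham_basis :: "('a dpoly \<Rightarrow> 'a dpoly) set" where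
  "ham_basis = (\<lambda>a. ham (dp_monomial a)) ` basis_indices"

sublocale W: Module.module class_ring W
  unfolding W_def by (rule jacobson_witt_module)

lemma W_operations [simp]:
  "\<zero>\<^bsub>W\<^esub> = restrict (\<lambda>f. \<zero>\<^bsub>O_alg\<^esub>) O_carrier"
  "D \<oplus>\<^bsub>W\<^esub> E = restrict (\<lambda>f. D f \<oplus>\<^bsub>O_alg\<^esub> E f) O_carrier"
  "c \<odot>\<^bsub>W\<^esub> D = restrict (\<lambda>f. c \<odot>\<^bsub>O_alg\<^esub> D f) O_carrier"
  by (simp_all add: W_def jacobson_witt_algebra_def O_alg_def Let_def del: divided_power_algebra_simps)

lemma W_ham:
  "ham f \<oplus>\<^bsub>W\<^esub> ham g = ham (\<lambda>a. f a + g a)" "c \<odot>\<^bsub>W\<^esub> ham f = ham (\<lambda>a. c * f a)"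
  "\<zero>\<^bsub>W\<^esub> = ham (\<lambda>a. 0)"
  by (auto intro!: restrict_eq_extensionalI ham_extensional simp: ham_add ham_smult ham_zero)

lemma ham_in_W:
  assumes f: "f \<in> O_carrier"
  shows "ham f \<in> carrier W"
proof -
  \<comment> \<open>As a vector field, \<open>ham f\<close> is - f_y d/dx + f_x d/dy;
    \<open>?F\<close> lists these two coefficients.\<close>
  let ?F = "\<lambda>i. if i = 1 then (\<lambda>a. (- 1) * dp_partial 2 f a) else dp_partial (Suc 0) f"
  have 12: "{Suc 0..2} = {Suc 0, 2}" by auto
  have "?F i \<in> O_carrier" for i
    using dp_partial_carrier[OF f, of 1] O.smult_closed[OF _ dp_partial_carrier[OF f, of 2], of "- 1"] by simp
  moreover have "restrict (\<lambda>g a. \<Sum>i\<in>{1..2}. (?F i \<otimes>\<^bsub>O_alg\<^esub> dp_partial i g) a) O_carrier = ham f"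
    unfolding 12 One_nat_def
    by (rule restrict_eq_extensionalI[OF ham_extensional])
      (simp add: ham_eq O_mult_linear(3)[of "- 1", simplified])
  ultimately show ?thesis
    unfolding W_def jacobson_witt_algebra_def Let_def operator_lie_algebra_simps O_alg_def[symmetric]
    by (intro CollectI exI[of _ ?F] conjI ballI) (simp_all only:)
qed

text \<open>\<open>lincomb\<close> runs over a set of operators, with coefficients indexed by
  operators. Injectivity ensures that each operator comes from one monomial of
  \<open>J\<close>.\<close>

lemma lincomb_ham:
  assumes "finite J" "J \<subseteq> multi_indices 3 2 heights" "inj_on (\<lambda>a. ham (dp_monomial a)) J"
  shows "W.lincomb c ((\<lambda>a. ham (dp_monomial a)) ` J) =
    ham (\<lambda>a. if a \<in> J then c (ham (dp_monomial a)) else 0)"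
  using assms
proof (induction J rule: finite_induct)
  case empty
  then show ?case by (simp add: W.lincomb_def W_ham(3)[symmetric])
next
  case (insert b J)
  have mono: "ham (dp_monomial a) \<in> carrier W" if "a \<in> multi_indices 3 2 heights" for a
    using that by (auto intro!: ham_in_W dp_monomial_carrier simp: multi_indices_eq)
  have "W.lincomb c ((\<lambda>a. ham (dp_monomial a)) ` J \<union> {ham (dp_monomial b)})
      = c (ham (dp_monomial b)) \<odot>\<^bsub>W\<^esub> ham (dp_monomial b) \<oplus>\<^bsub>W\<^esub> W.lincomb c ((\<lambda>a. ham (dp_monomial a)) ` J)"
    using insert by (intro W.lincomb_insert) (auto simp: mono image_iff)
  also have "\<dots> = ham (\<lambda>a. c (ham (dp_monomial b)) * dp_monomial b a
      + (if a \<in> J then c (ham (dp_monomial a)) else 0))"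
    using insert by (simp only: W_ham inj_on_insert insert_subset)
  also have "\<dots> = ham (\<lambda>a. if a \<in> insert b J then c (ham (dp_monomial a)) else 0)"
    using insert.hyps by (intro arg_cong[of _ _ ham] ext) (auto simp: dp_monomial_def)
  finally show ?case by simp
qed

lemma basis_indices_subset: "basis_indices \<subseteq> multi_indices 3 2 heights"
  by (auto simp: basis_indices_def)

lemma finite_basis_indices: "finite basis_indices"
  using finite_multi_indices by (simp add: basis_indices_def)

lemma inj_ham_monomial: "inj_on (\<lambda>a. ham (dp_monomial a)) basis_indices"
proof (rule inj_onI)
  fix a b assume a: "a \<in> basis_indices" and b: "b \<in> basis_indices"
    and eq: "ham (dp_monomial a) = ham (dp_monomial b)"
  have "dp_monomial a \<in> O_carrier" "dp_monomial b \<in> O_carrier"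
    using a b by (auto simp: basis_indices_def multi_indices_eq intro!: dp_monomial_carrier)
  with eq have "dp_monomial a a = (dp_monomial b a :: 'a)"
    using ham_eq_iff a by (auto simp: basis_indices_def)
  then show "a = b" by (simp add: dp_monomial_def split: if_splits)
qed

lemma lincomb_basis:
  assumes "J \<subseteq> basis_indices"
  shows "W.lincomb c ((\<lambda>a. ham (dp_monomial a)) ` J) =
    ham (\<lambda>a. if a \<in> J then c (ham (dp_monomial a)) else 0)"
  using assms basis_indices_subset finite_basis_indices inj_ham_monomial
  by (intro lincomb_ham) (auto intro: finite_subset inj_on_subset)

lemma cutoff_in_O_top: "J \<subseteq> basis_indices \<Longrightarrow> (\<lambda>a. if a \<in> J then u a else 0) \<in> O_top"
  using basis_indices_subset by (auto simp: O_top_def O_carrier_iff basis_indices_def)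

lemma ham_eq_cutoff:
  assumes "f \<in> O_top"
  shows "ham f = ham (\<lambda>a. if a \<in> basis_indices then f a else 0)"
  using assms cutoff_in_O_top[of basis_indices f]
  by (subst ham_eq_iff) (auto simp: O_top_def O_carrier_iff basis_indices_def)

lemma ham_basis_subset: "ham_basis \<subseteq> carrier W"
  using basis_indices_subset
  by (auto simp: ham_basis_def multi_indices_eq intro!: ham_in_W dp_monomial_carrier)

lemma finite_ham_basis: "finite ham_basis"
  by (simp add: ham_basis_def finite_basis_indices)

text \<open>This replaces the span in the definition of the algebra by the image of a set of
  functions, so that its elements can be handled as \<open>ham f\<close>.\<close>

lemma span_ham_basis: "W.span ham_basis = ham ` O_top"
proof
  show "W.span ham_basis \<subseteq> ham ` O_top"
  proof
    fix D assume "D \<in> W.span ham_basis"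
    then obtain A c where D: "D = W.lincomb c A" "A \<subseteq> ham_basis"
      by (auto simp: W.span_def)
    then obtain J where "J \<subseteq> basis_indices" "A = (\<lambda>a. ham (dp_monomial a)) ` J"
      unfolding ham_basis_def by (blast elim: subset_imageE)
    then show "D \<in> ham ` O_top"
      using D cutoff_in_O_top by (simp add: lincomb_basis)
  qed
  show "ham ` O_top \<subseteq> W.span ham_basis"
  proof (rule image_subsetI)
    fix f assume f: "f \<in> O_top"
    \<comment> \<open>Coefficients are indexed by operators; the inverse of the injection recovers
      the monomial.\<close>
    define c where "c = (\<lambda>v. f (inv_into basis_indices (\<lambda>a. ham (dp_monomial a)) v))"
    have "W.lincomb c ham_basis = ham (\<lambda>a. if a \<in> basis_indices then f a else 0)"
      unfolding ham_basis_def lincomb_basis[OF subset_refl]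
      by (intro arg_cong[of _ _ ham]) (auto simp: c_def inv_into_f_f[OF inj_ham_monomial])
    also have "\<dots> = ham f"
      using ham_eq_cutoff[OF f] by simp
    finally show "ham f \<in> W.span ham_basis"
      using finite_ham_basis unfolding W.span_def by (intro CollectI exI[of _ c] exI[of _ ham_basis]) simp
  qed
qed

section \<open>The Hamiltonian algebra with an explicit carrier\<close>

definition H :: "('a, 'a dpoly \<Rightarrow> 'a dpoly) lie_algebra" where
  "H = operator_lie_algebra O_alg (ham ` O_top)"

lemma hamiltonian_algebra_eq: "hamiltonian_algebra 1 heights = W\<lparr>carrier := W.span ham_basis\<rparr>"
proof -
  have "top_index 3 2 heights = top"
    by (auto simp: top_index_def top_def heights_def bi_index_def)
  then have "{D_H 1 heights (dp_monomial a) | a. a \<in> multi_indices CHAR('a) (2 * 1) heights \<and>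
      a \<noteq> (\<lambda>_. 0) \<and> a \<noteq> top_index CHAR('a) (2 * 1) heights} = ham_basis"
    by (auto simp: ham_basis_def basis_indices_def ham_def char_3)
  then show ?thesis
    unfolding hamiltonian_algebra_def Let_def by (simp only: W_def mult_1_right)
qed

lemma H_eq: "hamiltonian_algebra 1 heights = H"
  unfolding hamiltonian_algebra_eq span_ham_basis
  by (simp add: H_def W_def jacobson_witt_algebra_def Let_def O_alg_def operator_lie_algebra_def)

lemma H_simps:
  "carrier H = ham ` O_top" "\<zero>\<^bsub>H\<^esub> = ham (\<lambda>a. 0)"
  "ham f \<oplus>\<^bsub>H\<^esub> ham g = ham (\<lambda>a. f a + g a)" "c \<odot>\<^bsub>H\<^esub> ham f = ham (\<lambda>a. c * f a)"
  using W_ham by (simp_all add: H_def)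

lemma H_bracket:
  assumes "f \<in> O_carrier" "g \<in> O_carrier"
  shows "bracket H (ham f) (ham g) = ham (ham f g)"
proof -
  have "ham f (ham g h) \<ominus>\<^bsub>O_alg\<^esub> ham g (ham f h) = ham (ham f g) h" if "h \<in> O_carrier" for h
    using that assms by (simp add: ham_commutator O_minus ham_closed)
  then show ?thesis
    by (auto simp: H_def intro!: restrict_eq_extensionalI ham_extensional)
qed

lemma O_top_linear:
  "(\<lambda>a. 0) \<in> O_top" "f \<in> O_top \<Longrightarrow> g \<in> O_top \<Longrightarrow> (\<lambda>a. f a + g a) \<in> O_top"
  "f \<in> O_top \<Longrightarrow> (\<lambda>a. c * f a) \<in> O_top"
  by (auto simp: O_top_def O_carrier_iff)

lemma H_lie_algebra: "lie_algebra class_ring H"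
  unfolding H_def
proof (rule O.operator_lie_algebra_lie)
  show "ham ` O_top \<subseteq> LinearCombinations.module_hom class_ring O_alg O_alg \<inter> extensional O_carrier"
    using ham_module_hom ham_extensional by blast
  show "restrict (\<lambda>x. \<zero>\<^bsub>O_alg\<^esub>) O_carrier \<in> ham ` O_top"
    using W_ham(3) O_top_linear(1) by simp
  show "restrict (\<lambda>x. D x \<oplus>\<^bsub>O_alg\<^esub> E x) O_carrier \<in> ham ` O_top"
    if "D \<in> ham ` O_top" "E \<in> ham ` O_top" for D E
    using that W_ham(1) O_top_linear(2) by auto
  show "restrict (\<lambda>x. c \<odot>\<^bsub>O_alg\<^esub> D x) O_carrier \<in> ham ` O_top" if "D \<in> ham ` O_top" for c D
    using that W_ham(2) O_top_linear(3) by auto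
  show "restrict (\<lambda>x. D (E x) \<ominus>\<^bsub>O_alg\<^esub> E (D x)) O_carrier \<in> ham ` O_top"
    if DE: "D \<in> ham ` O_top" "E \<in> ham ` O_top" for D E
  proof -
    obtain f g where "f \<in> O_top" "g \<in> O_top" "D = ham f" "E = ham g"
      using DE by auto
    then show ?thesis
      using H_bracket[of f g] ham_O_top[of f g] by (simp add: O_top_def H_def)
  qed
  show "field (class_ring :: 'a ring)" by (rule class_field)
qed

sublocale H: lie_algebra class_ring H
  by (rule H_lie_algebra)

section \<open>Basis and dimension\<close>

lemma H_eq_W: "H = W\<lparr>carrier := W.span ham_basis\<rparr>"
  using H_eq hamiltonian_algebra_eq by simp

lemma ham_basis_in_span: "ham_basis \<subseteq> W.span ham_basis"
  by (rule W.in_own_span[OF ham_basis_subset])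

lemma H_span: "H.span ham_basis = carrier H"
  using W.span_li_not_depend(1)[OF ham_basis_in_span W.span_is_submodule[OF ham_basis_subset]]
  by (simp add: H_eq_W)

lemma H_basis: "H.basis ham_basis"
proof -
  have sub: "ham_basis \<subseteq> carrier H"
    using ham_basis_in_span by (simp add: H_eq_W)
  have "H.lin_indpt ham_basis"
  proof (rule H.finite_lin_indpt2[OF finite_ham_basis sub])
    show "\<forall>v\<in>ham_basis. c v = \<zero>\<^bsub>class_ring\<^esub>"
      if c: "c \<in> ham_basis \<rightarrow> carrier class_ring" "H.lincomb c ham_basis = \<zero>\<^bsub>H\<^esub>" for c
    proof -
      \<comment> \<open>\<open>H\<close> is a subspace of \<open>W\<close> with the same operations,
        so the combination can be computed in \<open>W\<close>, where \<open>lincomb_basis\<close>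
        applies.\<close>
      have "W.lincomb c ham_basis = H.lincomb c ham_basis"
        unfolding H_eq_W
        by (rule W.lincomb_not_depend[OF finite_ham_basis ham_basis_in_span
            W.span_is_submodule[OF ham_basis_subset] c(1)])
      then have "ham (\<lambda>a. if a \<in> basis_indices then c (ham (dp_monomial a)) else 0) = ham (\<lambda>a. 0)"
        using c(2) lincomb_basis[OF subset_refl] by (simp add: ham_basis_def H_simps)
      then have "(if a \<in> basis_indices then c (ham (dp_monomial a)) else 0) = 0" if "a \<in> basis_indices" for a
        using that cutoff_in_O_top[OF subset_refl] O_top_linear(1)
        by (subst (asm) ham_eq_iff) (auto simp: O_top_def basis_indices_def)
      then show ?thesis by (auto simp: ham_basis_def)
    qed
  qed
  then show ?thesis
    using H_span sub by (simp add: H.basis_def)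
qed

lemma card_ham_basis: "card ham_basis = 3 ^ (n + 1) - 2"
proof -
  have "inj_on (\<lambda>(i, j). bi_index i j) ({..<3} \<times> {..<3 ^ n})"
    by (auto simp: inj_on_def)
  then have "card (multi_indices 3 2 heights) = 3 * 3 ^ n"
    unfolding multi_indices_eq by (subst card_image) simp_all
  moreover have "{\<lambda>_. 0, top} \<subseteq> multi_indices 3 2 heights"
    by (simp add: bi_index_0_0[symmetric] top_def)
  moreover have "card {\<lambda>_. 0, top} = 2"
    by (simp add: bi_index_0_0[symmetric] top_def)
  ultimately have "card basis_indices = 3 * 3 ^ n - 2"
    unfolding basis_indices_def by (subst card_Diff_subset) simp_all
  then show ?thesis
    by (simp add: ham_basis_def card_image[OF inj_ham_monomial])
qed

lemma H_dim: "H.fin_dim" "H.dim = 3 ^ (n + 1) - 2"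
  using H_basis finite_ham_basis H.dim_basis[OF finite_ham_basis H_basis] card_ham_basis
  by (auto simp: H.fin_dim_def H.basis_def)

section \<open>Brackets with monomials of degree 1 and 2, and simplicity\<close>

lemma hs_nth_row_Y: "hs_nth (row Y 0 * h) k = of_nat k * hs_nth h (k - 1)"
proof -
  have "hs_nth (row Y 0 * h) k = (\<Sum>i\<le>k. if i = 1 then of_nat (k choose 1) * hs_nth h (k - 1) else 0)"
    unfolding hs_nth_mult row_dp_monomial by (rule sum.cong) auto
  also have "\<dots> = of_nat k * hs_nth h (k - 1)"
    \<comment> \<open>At \<open>k = 0\<close> the value \<open>k - 1\<close> is again 0, but the
      factor \<open>of_nat k\<close> vanishes.\<close>
    by (cases k) simp_all
  finally show ?thesis .
qed

abbreviation X2 :: "'a dpoly" where "X2 \<equiv> dp_monomial (bi_index 2 0)"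
abbreviation Y2 :: "'a dpoly" where "Y2 \<equiv> dp_monomial (bi_index 0 2)"
abbreviation XY :: "'a dpoly" where "XY \<equiv> dp_monomial (bi_index (Suc 0) (Suc 0))"

lemma dp_monomial_O_top:
  assumes "i < 3" "j < 3 ^ n" "(i, j) \<noteq> (2, 3 ^ n - 1)"
  shows "dp_monomial (bi_index i j) \<in> O_top"
proof -
  have "dp_monomial (bi_index i j) (bi_index 2 (3 ^ n - 1)) = (0 :: 'a)"
    using assms by (auto simp: dp_monomial_def)
  then show ?thesis
    using assms by (simp add: O_top_def top_def dp_monomial_carrier)
qed

lemma quadratic_rows [simp]:
  "row X2 0 = 0" "row X2 (Suc 0) = 0" "row X2 2 = 1"
  "hs_deriv (row Y2 0) = row Y 0" "row Y2 (Suc 0) = 0" "row Y2 2 = 0"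
  "row XY 0 = 0" "row XY (Suc 0) = row Y 0" "row XY 2 = 0"
  by (auto intro!: hs_eqI simp: row_dp_monomial hs_nth_1 simp del: hs_nth_row)

lemma quadratic_O_top: "X \<in> O_top" "Y \<in> O_top" "X2 \<in> O_top" "Y2 \<in> O_top" "XY \<in> O_top"
proof -
  have "1 < (3::nat) ^ n" "2 < (3::nat) ^ n" "(3::nat) ^ n - 1 \<noteq> 0" "Suc 0 \<noteq> 3 ^ n - 1"
    using power_3_n_ge by linarith+
  then show "X \<in> O_top" "Y \<in> O_top" "X2 \<in> O_top" "Y2 \<in> O_top" "XY \<in> O_top"
    by (simp_all add: dp_monomial_O_top)
qed

lemma two_eq: "(2 :: 'a) = - 1"
  using three_eq_0 by (simp add: eq_neg_iff_add_eq_0)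

text \<open>These are the vector fields - d/dy, d/dx, - x d/dy, y d/dx and x d/dx - y d/dy. The last
  is diagonal on monomials, and the sign in the third formula at \<open>i = 2\<close> uses 2 =
  -1.\<close>

lemma coeff_ham:
  assumes f: "f \<in> O_carrier" and i: "i < 3"
  shows coeff_ham_X: "ham f X (bi_index i j) = - f (bi_index i (Suc j))"
    and coeff_ham_Y: "ham f Y (bi_index i j) = f (bi_index (Suc i) j)"
    and coeff_ham_X2: "ham f X2 (bi_index i j) =
      (if i = 0 then 0 else if i = 1 then - f (bi_index 0 (Suc j)) else f (bi_index 1 (Suc j)))"
    and coeff_ham_Y2: "ham f Y2 (bi_index i j) = of_nat j * f (bi_index (Suc i) (j - 1))"
    and coeff_ham_XY: "ham f XY (bi_index i j) = (of_nat i - of_nat j) * f (bi_index i j)"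
proof -
  have i3: "i = 0 \<or> i = Suc 0 \<or> i = 2" using i by auto
  note quad = quadratic_O_top[THEN O_topD(1)]
  have hs: "ham f g (bi_index i j) = hs_nth (row (ham f g) i) j" for g by simp
  have f3: "f (bi_index 3 k) = 0" for k using f by (simp add: O_carrier_bi_index)
  have "row (ham f X) 0 = - hs_deriv (row f 0)" "row (ham f X) (Suc 0) = - hs_deriv (row f (Suc 0))"
    "row (ham f X) 2 = - hs_deriv (row f 2)"
    by (simp_all add: row_ham f quad)
  then show "ham f X (bi_index i j) = - f (bi_index i (Suc j))"
    using i3 unfolding hs by (elim disjE) (simp_all)
  have "row (ham f Y) 0 = row f (Suc 0)" "row (ham f Y) (Suc 0) = row f 2"
    "row (ham f Y) 2 = 0"
    by (simp_all add: row_ham f quad)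
  then show "ham f Y (bi_index i j) = f (bi_index (Suc i) j)"
    using i3 unfolding hs by (elim disjE) (simp_all add: f3 flip: numeral_2_eq_2)
  have "row (ham f X2) 0 = 0" "row (ham f X2) (Suc 0) = - hs_deriv (row f 0)"
    "row (ham f X2) 2 = hs_deriv (row f (Suc 0))"
    by (simp_all add: row_ham f quad)
  then show "ham f X2 (bi_index i j) =
      (if i = 0 then 0 else if i = 1 then - f (bi_index 0 (Suc j)) else f (bi_index 1 (Suc j)))"
    using i3 unfolding hs by (elim disjE) (simp_all)
  have "row (ham f Y2) 0 = row Y 0 * row f (Suc 0)" "row (ham f Y2) (Suc 0) = row Y 0 * row f 2"
    "row (ham f Y2) 2 = 0"
    by (simp_all add: row_ham f quad)
  then show "ham f Y2 (bi_index i j) = of_nat j * f (bi_index (Suc i) (j - 1))"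
    using i3 unfolding hs by (elim disjE) (simp_all add: hs_nth_row_Y f3 flip: numeral_2_eq_2)
  have "row (ham f XY) 0 = - (row Y 0 * hs_deriv (row f 0))" "row (ham f XY) (Suc 0) = row f (Suc 0) - row Y 0 * hs_deriv (row f (Suc 0))"
    "row (ham f XY) 2 = - row f 2 - row Y 0 * hs_deriv (row f 2)"
    by (simp_all add: row_ham f quad)
  then show "ham f XY (bi_index i j) = (of_nat i - of_nat j) * f (bi_index i j)"
    using i3 unfolding hs
    by (elim disjE; cases j) (simp_all add: hs_nth_row_Y left_diff_distrib distrib_right two_eq)
qed

lemma O_smult: "f \<in> O_carrier \<Longrightarrow> (\<lambda>a. c * f a) \<in> O_carrier"
  using O.smult_closed[of c f] by simp

lemma lie_ideal_H_trivial:
  assumes I: "lie_ideal class_ring H I"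
  shows "I = {\<zero>\<^bsub>H\<^esub>} \<or> I = carrier H"
proof (rule disjCI)
  assume nontrivial: "I \<noteq> carrier H"
  interpret I: LinearCombinations.submodule class_ring I H
    using I by (simp add: lie_ideal_def)
  \<comment> \<open>The ideal is pulled back along \<open>ham\<close>, so that the argument can work
    with functions and their coefficients.\<close>
  define J where "J = {f \<in> O_top. ham f \<in> I}"
  have J_carrier: "f \<in> O_carrier" if "f \<in> J" for f
    using that by (simp add: J_def O_top_def)
  have J_smult: "(\<lambda>a. c * f a) \<in> J" if "f \<in> J" for c f
    using that I.smult_closed[of c "ham f"] by (simp add: J_def O_top_linear H_simps)
  have J_ham: "ham f g \<in> J" if "f \<in> J" "g \<in> O_top" for f g
    using that H.lie_ideal_bracket_left[OF I, of "ham f" "ham g"]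
    by (simp add: J_def H_simps H_bracket O_topD ham_O_top)
  have J_ham': "ham g f \<in> J" if "f \<in> J" "g \<in> O_top" for f g
    using that I by (simp add: J_def lie_ideal_def H_simps H_bracket[symmetric] O_topD ham_O_top)
  have J_scaled: "g \<in> J" if "f \<in> J" "f = (\<lambda>a. c * g a)" "c \<noteq> 0" for f g c
  proof -
    have "(\<lambda>a. inverse c * f a) = g" using that(2,3) by (simp add: mult.assoc[symmetric])
    then show ?thesis using J_smult[OF that(1), of "inverse c"] by simp
  qed
  \<comment> \<open>A nonconstant function is one that \<open>ham\<close> does not annihilate;
    \<open>bounded d\<close> limits the total degree to \<open>d\<close>.\<close>
  define nonconst where "nonconst f \<longleftrightarrow> (\<exists>i j. (i, j) \<noteq> (0, 0) \<and> f (bi_index i j) \<noteq> 0)" for f :: "'a dpoly"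
  define bounded where "bounded d f \<longleftrightarrow> (\<forall>i j. d < i + j \<longrightarrow> f (bi_index i j) = 0)"
    for d and f :: "'a dpoly"
  show "I = {\<zero>\<^bsub>H\<^esub>}"
  proof (rule ccontr)
    assume "I \<noteq> {\<zero>\<^bsub>H\<^esub>}"
    then obtain D where D: "D \<in> I" "D \<noteq> \<zero>\<^bsub>H\<^esub>"
      using I.zero_closed by blast
    then obtain f where f: "f \<in> O_top" "D = ham f"
      using I.subset by (auto simp: H_simps)
    have "nonconst f"
    proof (rule ccontr)
      assume "\<not> nonconst f"
      then have "f (bi_index i j) = 0" if "(i, j) \<noteq> (0, 0)" for i j
        using that unfolding nonconst_def by blast
      then have "ham f = ham (\<lambda>a. 0)"
        using f O_top_linear(1) by (subst ham_eq_iff_rows) (auto simp: O_top_def intro!: hs_eqI)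
      then show False using D f by (simp add: H_simps)
    qed
    moreover have "bounded (2 + 3 ^ n) f"
      unfolding bounded_def
    proof (intro allI impI)
      fix i j :: nat assume "2 + 3 ^ n < i + j"
      then have "\<not> (i < 3 \<and> j < 3 ^ n)" by auto
      then show "f (bi_index i j) = 0"
        using f by (intro O_carrier_bi_index) (auto simp: O_top_def)
    qed
    \<comment> \<open>Descent on the degree bound. A nonconstant partial derivative has a smaller
      bound and stays in \<open>J\<close>; if both partial derivatives are constant,
      \<open>f\<close> already has degree at most 1.\<close>
    moreover have "\<exists>g\<in>J. nonconst g \<and> bounded 1 g" if "f \<in> J" "nonconst f" "bounded d f" for d f
      using that
    proof (induction d arbitrary: f)
      case 0
      then have "bounded 1 f" by (simp add: bounded_def del: add_gr_0)
      then show ?case using 0 by blast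
    next
      case (Suc d)
      have coeff: "ham f X (bi_index i j) = - f (bi_index i (Suc j))"
        "ham f Y (bi_index i j) = f (bi_index (Suc i) j)" for i j
        using coeff_ham_X[OF J_carrier[OF Suc.prems(1)], of i j]
          coeff_ham_Y[OF J_carrier[OF Suc.prems(1)], of i j]
          O_carrier_bi_index[OF J_carrier[OF Suc.prems(1)]]
          O_carrier_bi_index[OF ham_closed, of _ i j f] by (cases "i < 3"; simp)+
      have closed: "ham f X \<in> J" "ham f Y \<in> J"
        using J_ham Suc.prems(1) quadratic_O_top by auto
      have bounds: "bounded d (ham f X)" "bounded d (ham f Y)"
        using Suc.prems(3) by (auto simp: bounded_def coeff)
      show ?case
      proof (cases "nonconst (ham f X) \<or> nonconst (ham f Y)")
        case True
        then show ?thesis using Suc.IH closed bounds by blast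
      next
        case False
        have "bounded 1 f"
          unfolding bounded_def
        proof (intro allI impI)
          fix i j :: nat assume ij: "1 < i + j"
          show "f (bi_index i j) = 0"
          proof (cases j)
            case (Suc k)
            then have "(i, k) \<noteq> (0, 0)" using ij by auto
            then have "ham f X (bi_index i k) = 0"
              using False unfolding nonconst_def by blast
            then show ?thesis using Suc by (simp add: coeff)
          next
            case 0
            then obtain k where "i = Suc k" "k \<noteq> 0" using ij by (cases i) auto
            then have "(k, j) \<noteq> (0, 0)" by simp
            then have "ham f Y (bi_index k j) = 0"
              using False unfolding nonconst_def by blast
            then show ?thesis using \<open>i = Suc k\<close> by (simp add: coeff)
          qed
        qed
        then show ?thesis using Suc.prems by blast
      qed
    qed
    ultimately obtain g where g: "g \<in> J" "nonconst g" "bounded 1 g"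
      using D f by (auto simp: J_def)
    have g_linear: "g (bi_index i j) = 0" if "i + j > 1" for i j
      using g(3) that by (simp add: bounded_def)
    note gc = J_carrier[OF g(1)]
    \<comment> \<open>Up to a constant, \<open>g\<close> is a linear form a X + b Y. If b is
      nonzero, the bracket with \<open>X2\<close> leaves - b X, and \<open>Y2\<close> turns X into
      Y. If b is zero, \<open>Y2\<close> leaves a Y, and \<open>X2\<close> turns Y into X.\<close>
    have XY: "X \<in> J \<and> Y \<in> J"
    proof (cases "g (bi_index 0 1) = 0")
      case False
      have "ham g X2 = (\<lambda>a. (- g (bi_index 0 1)) * X a)"
      proof (rule O_eqI)
        show "ham g X2 (bi_index i j) = - g (bi_index 0 1) * X (bi_index i j)" if "i < 3" for i j
          unfolding coeff_ham_X2[OF gc that] using g_linear by (auto simp: dp_monomial_def)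
      qed (intro ham_closed O_smult XY_rows O_topD(1) quadratic_O_top)+
      then have "X \<in> J"
        by (rule J_scaled[OF J_ham[OF g(1) quadratic_O_top(3)]]) (use False in simp)
      moreover have "ham X Y2 = (\<lambda>a. 1 * Y a)"
        using quadratic_O_top by (intro row_eqI) (simp_all add: O_top_def row_ham ham_closed)
      then have "Y \<in> J"
        by (rule J_scaled[OF J_ham[OF \<open>X \<in> J\<close> quadratic_O_top(4)]]) simp
      ultimately show ?thesis by simp
    next
      case True
      have a: "g (bi_index 1 0) \<noteq> 0"
      proof -
        obtain i j where ij: "(i, j) \<noteq> (0, 0)" "g (bi_index i j) \<noteq> 0"
          using g(2) by (auto simp: nonconst_def)
        then have "i + j \<le> 1" using g_linear[of i j] by force
        then have "i = 1 \<and> j = 0 \<or> i = 0 \<and> j = 1" using ij(1) by auto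
        then show ?thesis using ij(2) True by auto
      qed
      have "ham g Y2 = (\<lambda>a. g (bi_index 1 0) * Y a)"
      proof (rule O_eqI)
        show "ham g Y2 (bi_index i j) = g (bi_index 1 0) * Y (bi_index i j)" if "i < 3" for i j
          unfolding coeff_ham_Y2[OF gc that] using g_linear[of "Suc i" "j - 1"]
          by (cases j) (auto simp: dp_monomial_def)
      qed (intro ham_closed O_smult XY_rows O_topD(1) quadratic_O_top)+
      then have "Y \<in> J"
        by (rule J_scaled[OF J_ham[OF g(1) quadratic_O_top(4)]]) (rule a)
      moreover have "ham X2 Y = (\<lambda>a. 1 * X a)"
        using quadratic_O_top by (intro row_eqI) (simp_all add: O_top_def row_ham ham_closed)
      then have "X \<in> J"
        by (rule J_scaled[OF J_ham'[OF \<open>Y \<in> J\<close> quadratic_O_top(3)]]) simp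
      ultimately show ?thesis by simp
    qed
    let ?m = "\<lambda>i j. dp_monomial (bi_index i j) :: 'a dpoly"
    \<comment> \<open>A nonzero multiple of a monomial in \<open>J\<close> puts the monomial itself
      into \<open>J\<close>.\<close>
    have mono_step: "?m i j \<in> J"
      if "h \<in> J" "h \<in> O_carrier" "c \<noteq> 0" "i < 3" "j < 3 ^ n"
        "\<And>k l. k < 3 \<Longrightarrow> l < 3 ^ n \<Longrightarrow> h (bi_index k l) = c * ?m i j (bi_index k l)" for h c i j
    proof -
      have "h = (\<lambda>a. c * ?m i j a)"
        using that by (intro O_eqI O_smult dp_monomial_carrier) simp_all
      then show ?thesis using J_scaled that(1,3) by blast
    qed
    have lower_y: "?m i j \<in> J" if "i < 3" "Suc j < 3 ^ n" "(i, Suc j) \<noteq> (2, 3 ^ n - 1)" for i j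
    proof (rule mono_step[of "ham (?m i (Suc j)) X" "- 1"])
      have m: "?m i (Suc j) \<in> O_top" using that by (intro dp_monomial_O_top) auto
      then show "ham (?m i (Suc j)) X \<in> J" using J_ham' XY by simp
      then show "ham (?m i (Suc j)) X \<in> O_carrier" by (rule J_carrier)
      show "ham (?m i (Suc j)) X (bi_index k l) = - 1 * ?m i j (bi_index k l)" if "k < 3" for k l
        using that O_topD(1)[OF m] by (simp add: coeff_ham_X) (simp add: dp_monomial_def)
    qed (use that in auto)
    have lower_x: "?m i j \<in> J" if "Suc i < 3" "j < 3 ^ n" "(Suc i, j) \<noteq> (2, 3 ^ n - 1)" for i j
    proof (rule mono_step[of "ham (?m (Suc i) j) Y" 1])
      have m: "?m (Suc i) j \<in> O_top" using that by (intro dp_monomial_O_top) auto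
      then show "ham (?m (Suc i) j) Y \<in> J" using J_ham' XY by simp
      then show "ham (?m (Suc i) j) Y \<in> O_carrier" by (rule J_carrier)
      show "ham (?m (Suc i) j) Y (bi_index k l) = 1 * ?m i j (bi_index k l)" if "k < 3" for k l
        using that O_topD(1)[OF m] by (simp add: coeff_ham_Y) (simp add: dp_monomial_def)
    qed (use that in auto)
    have q: "3 \<le> (3::nat) ^ n" by (rule power_3_n_ge)
    have XY_J: "XY \<in> J"
      using q by (intro lower_y) auto
    \<comment> \<open>The bracket with \<open>XY\<close> multiplies the monomial by i - j, which is
      invertible here, so no larger monomial is required.\<close>
    have weight: "?m i j \<in> J"
      if "i < 3" "j < 3 ^ n" "(i, j) \<noteq> (2, 3 ^ n - 1)" "of_nat i \<noteq> (of_nat j :: 'a)" for i j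
    proof (rule mono_step[of "ham (?m i j) XY" "of_nat i - of_nat j"])
      have m: "?m i j \<in> O_top" using that by (intro dp_monomial_O_top) auto
      then show "ham (?m i j) XY \<in> J" using J_ham' XY_J by simp
      then show "ham (?m i j) XY \<in> O_carrier" by (rule J_carrier)
      show "ham (?m i j) XY (bi_index k l) = (of_nat i - of_nat j) * ?m i j (bi_index k l)" if "k < 3" for k l
        using that O_topD(1)[OF m] by (simp add: coeff_ham_XY) (simp add: dp_monomial_def)
    qed (use that in auto)
    have "ham_basis \<subseteq> I"
    proof
      fix D assume "D \<in> ham_basis"
      then obtain i j where ij: "D = ham (?m i j)" "i < 3" "j < 3 ^ n" "(i, j) \<noteq> (2, 3 ^ n - 1)"
        by (auto simp: ham_basis_def basis_indices_def multi_indices_eq top_def)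
      have q0: "(of_nat (3 ^ n) :: 'a) = 0"
        using three_eq_0 n_pos by (simp add: power_0_left)
      have one_neq: "(1 :: 'a) \<noteq> - 1"
        using two_eq by (metis eq_neg_iff_add_eq_0 one_add_one neg_equal_0_iff_equal zero_neq_one)
      \<comment> \<open>Only the first two cases have an admissible monomial above them. For the
        third, raising \<open>i\<close> gives the excluded top index, and for the fourth raising
        \<open>j\<close> does; there the eigenvalues are 1 - (-1) and -1 - 1, both nonzero modulo
        3.\<close>
      consider "Suc j < 3 ^ n" "(i, Suc j) \<noteq> (2, 3 ^ n - 1)" | "i = 0" "j = 3 ^ n - 1"
        | "i = 1" "j = 3 ^ n - 1" | "i = 2" "j = 3 ^ n - 2"
        using ij(2-4) by force
      then have "?m i j \<in> J"
      proof cases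
        case 1
        then show ?thesis using ij by (intro lower_y) auto
      next
        case 2
        then show ?thesis using ij q by (intro lower_x) auto
      next
        case 3
        have "of_nat j = (of_nat (3 ^ n) - of_nat 1 :: 'a)"
          unfolding 3 using q by (intro of_nat_diff) simp
        then have "of_nat j = (- 1 :: 'a)" by (simp only: q0) simp
        moreover have "of_nat i = (1 :: 'a)" using 3 by simp
        ultimately have "of_nat i \<noteq> (of_nat j :: 'a)" using one_neq by (simp only: not_False_eq_True)
        then show ?thesis by (rule weight[OF ij(2-4)])
      next
        case 4
        have "of_nat j = (of_nat (3 ^ n) - of_nat 2 :: 'a)"
          unfolding 4 using q by (intro of_nat_diff) simp
        then have "of_nat j = (1 :: 'a)" by (simp only: q0) (simp add: two_eq)
        moreover have "of_nat i = (- 1 :: 'a)" using 4 by (simp add: two_eq)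
        ultimately have "of_nat i \<noteq> (of_nat j :: 'a)" using one_neq[symmetric] by (simp only: not_False_eq_True)
        then show ?thesis by (rule weight[OF ij(2-4)])
      qed
      then show "D \<in> I" using ij(1) by (simp add: J_def)
    qed
    then have "carrier H \<subseteq> I"
      using H.span_is_subset I.submodule_axioms H_span by metis
    then show False
      using nontrivial I.subset by blast
  qed
qed

lemma H_simple: "simple_lie_algebra class_ring H"
proof
  have "ham X2 Y = X"
    using quadratic_O_top by (intro row_eqI) (simp_all add: O_top_def row_ham ham_closed)
  then have "bracket H (ham X2) (ham Y) = ham X"
    using quadratic_O_top by (simp add: H_bracket O_top_def)
  moreover have "ham X \<noteq> \<zero>\<^bsub>H\<^esub>"
    using O_top_linear(1) by (simp add: H_simps ham_eq_iff_rows O_top_def)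
  ultimately show "\<exists>x\<in>carrier H. \<exists>y\<in>carrier H. bracket H x y \<noteq> \<zero>\<^bsub>H\<^esub>"
    using quadratic_O_top by (auto simp: H_simps)
  show "lie_ideal class_ring H I \<Longrightarrow> I = {\<zero>\<^bsub>H\<^esub>} \<or> I = carrier H" for I
    by (rule lie_ideal_H_trivial)
qed

end

section \<open>Outer derivations\<close>

context hamiltonian_char_3
begin

section \<open>From maps on generators to derivations of \<open>H\<close>\<close>

lemma H_minus:
  assumes "f \<in> O_top" "g \<in> O_top"
  shows "ham f \<ominus>\<^bsub>H\<^esub> ham g = ham (\<lambda>a. f a - g a)"
proof -
  have "\<ominus>\<^bsub>H\<^esub> ham g = (\<ominus>\<^bsub>class_ring\<^esub> 1) \<odot>\<^bsub>H\<^esub> ham g"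
    using H.minus_smult_minus_1[of "ham g"] assms by (simp add: H_simps)
  also have "\<dots> = ham (\<lambda>a. - 1 * g a)"
    by (simp add: H_simps class_ring_simps)
  finally show ?thesis
    by (simp add: H.minus_eq H_simps)
qed

text \<open>An element of \<open>H\<close> is an operator, which determines its generator up to a
  constant. The choice of a generator is harmless for maps that respect equality under
  \<open>ham\<close>.\<close>

definition lift_operator :: "('a dpoly \<Rightarrow> 'a dpoly) \<Rightarrow> ('a dpoly \<Rightarrow> 'a dpoly) \<Rightarrow> 'a dpoly \<Rightarrow> 'a dpoly" where
  "lift_operator \<phi> = restrict (\<lambda>D. ham (\<phi> (SOME f. f \<in> O_top \<and> D = ham f))) (carrier H)"

text \<open>The Leibniz rule is compared under \<open>ham\<close>, that is modulo constants: for
  \<open>lower\<close>, integrating the derivative in row 2 of a bracket loses a constant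
  term.\<close>

definition ham_derivation :: "('a dpoly \<Rightarrow> 'a dpoly) \<Rightarrow> bool" where
  "ham_derivation \<phi> \<longleftrightarrow>
    (\<forall>f\<in>O_top. \<phi> f \<in> O_top) \<and>
    (\<forall>f\<in>O_top. \<forall>g\<in>O_top. \<phi> (\<lambda>a. f a + g a) = (\<lambda>a. \<phi> f a + \<phi> g a)) \<and>
    (\<forall>c. \<forall>f\<in>O_top. \<phi> (\<lambda>a. c * f a) = (\<lambda>a. c * \<phi> f a)) \<and>
    (\<forall>f\<in>O_top. \<forall>g\<in>O_top. ham f = ham g \<longrightarrow> ham (\<phi> f) = ham (\<phi> g)) \<and>
    (\<forall>f\<in>O_top. \<forall>g\<in>O_top. ham (\<phi> (ham f g)) = ham (\<lambda>a. ham (\<phi> f) g a + ham f (\<phi> g) a))"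

lemma ham_derivationD:
  assumes "ham_derivation \<phi>" "f \<in> O_top"
  shows "\<phi> f \<in> O_top" "g \<in> O_top \<Longrightarrow> \<phi> (\<lambda>a. f a + g a) = (\<lambda>a. \<phi> f a + \<phi> g a)"
    "\<phi> (\<lambda>a. c * f a) = (\<lambda>a. c * \<phi> f a)"
    "g \<in> O_top \<Longrightarrow> ham f = ham g \<Longrightarrow> ham (\<phi> f) = ham (\<phi> g)"
    "g \<in> O_top \<Longrightarrow> ham (\<phi> (ham f g)) = ham (\<lambda>a. ham (\<phi> f) g a + ham f (\<phi> g) a)"
  using assms unfolding ham_derivation_def by blast+

lemma lift_operator_ham:
  assumes \<phi>: "ham_derivation \<phi>" and f: "f \<in> O_top"
  shows "lift_operator \<phi> (ham f) = ham (\<phi> f)"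
proof -
  define g where "g = (SOME g. g \<in> O_top \<and> ham f = ham g)"
  have "g \<in> O_top \<and> ham f = ham g"
    unfolding g_def by (rule someI[of _ f]) (simp add: f)
  then have "ham (\<phi> f) = ham (\<phi> g)"
    using ham_derivationD(4)[OF \<phi> f] by blast
  then show ?thesis
    using f by (simp add: lift_operator_def H_simps g_def)
qed

lemma lift_operator_derivation:
  assumes \<phi>: "ham_derivation \<phi>"
  shows "lift_operator \<phi> \<in> derivations class_ring H"
proof (rule H.derivationsI)
  note lift = lift_operator_ham[OF \<phi>]
  note closed = ham_derivationD(1)[OF \<phi>]
  show "lift_operator \<phi> \<in> extensional (carrier H)"
    by (simp add: lift_operator_def)
  show "lift_operator \<phi> x \<in> carrier H" if "x \<in> carrier H" for x
    using that closed by (auto simp: H_simps lift)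
  show "lift_operator \<phi> (x \<oplus>\<^bsub>H\<^esub> y) = lift_operator \<phi> x \<oplus>\<^bsub>H\<^esub> lift_operator \<phi> y"
    if "x \<in> carrier H" "y \<in> carrier H" for x y
    using that by (auto simp: H_simps lift O_top_linear ham_derivationD(2,3)[OF \<phi>])
  show "lift_operator \<phi> (c \<odot>\<^bsub>H\<^esub> x) = c \<odot>\<^bsub>H\<^esub> lift_operator \<phi> x"
    if "x \<in> carrier H" for c x
    using that by (auto simp: H_simps lift O_top_linear ham_derivationD(2,3)[OF \<phi>])
  show "lift_operator \<phi> (bracket H x y) =
      bracket H (lift_operator \<phi> x) y \<oplus>\<^bsub>H\<^esub> bracket H x (lift_operator \<phi> y)"
    if "x \<in> carrier H" "y \<in> carrier H" for x y
    using that closed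
    by (auto simp: H_simps lift H_bracket ham_O_top O_topD ham_derivationD(5)[OF \<phi>])
qed

text \<open>Commutator relations can be checked on generators and modulo constants.\<close>

lemma lift_operator_bracket:
  assumes \<phi>: "ham_derivation \<phi>" and \<psi>: "ham_derivation \<psi>" and \<chi>: "ham_derivation \<chi>"
    and eq: "\<And>f. f \<in> O_top \<Longrightarrow> ham (\<lambda>a. \<phi> (\<psi> f) a - \<psi> (\<phi> f) a) = ham (\<chi> f)"
  shows "bracket (Der class_ring H) (lift_operator \<phi>) (lift_operator \<psi>) = lift_operator \<chi>"
proof -
  note closed = ham_derivationD(1)[OF \<phi>] ham_derivationD(1)[OF \<psi>]
  show ?thesis
    unfolding Der_def operator_lie_algebra_simps
  proof (rule restrict_eq_extensionalI)
    show "lift_operator \<chi> \<in> extensional (carrier H)"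
      by (simp add: lift_operator_def)
    show "lift_operator \<phi> (lift_operator \<psi> x) \<ominus>\<^bsub>H\<^esub> lift_operator \<psi> (lift_operator \<phi> x) = lift_operator \<chi> x"
      if x: "x \<in> carrier H" for x
    proof -
      obtain f where "f \<in> O_top" "x = ham f" using x by (auto simp: H_simps)
      then show ?thesis
        by (simp add: lift_operator_ham \<phi> \<psi> \<chi> closed H_minus eq)
    qed
  qed
qed

text \<open>In terms of \<open>f = f\<^sub>0 + x f\<^sub>1 + x\<^sup>(\<^sup>2\<^sup>) f\<^sub>2\<close>, the map \<open>f\<^sub>0 \<mapsto> f\<^sub>0'\<close> identifies the components of
  degrees \<open>0\<close> and \<open>2\<close> in \<open>x\<close>, so that \<open>sl\<^sub>2\<close> acts on their sum.\<close>

definition raise :: "'a dpoly \<Rightarrow> 'a dpoly" where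
  "raise f = of_rows 0 0 (hs_deriv (row f 0))"

definition lower :: "'a dpoly \<Rightarrow> 'a dpoly" where
  "lower f = of_rows (hs_integral (row f 2)) 0 0"

definition degree_map :: "'a dpoly \<Rightarrow> 'a dpoly" where
  "degree_map f = of_rows (- row f 0) 0 (row f 2)"

text \<open>Integration moves the coefficient at \<open>3 ^ n - 1\<close> to \<open>3 ^ n\<close>.
  In row 2 this is the top coefficient, which vanishes on \<open>O_top\<close>.\<close>

lemma truncated_integral: "f \<in> O_top \<Longrightarrow> truncated (hs_integral (row f 2))"
  unfolding truncated_def
proof (intro allI impI)
  fix k :: nat assume f: "f \<in> O_top" and k: "3 ^ n \<le> k"
  show "hs_nth (hs_integral (row f 2)) k = 0"
  proof (cases "k = 3 ^ n")
    case True
    then show ?thesis using f by (simp add: hs_nth_integral O_top_def top_def)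
  next
    case False
    then have "3 ^ n \<le> k - 1" using k by simp
    then show ?thesis using truncated_row[OF O_topD(1)[OF f], of 2] by (simp add: hs_nth_integral truncated_def)
  qed
qed

lemma sl2_rows [simp]:
  assumes "f \<in> O_top"
  shows "row (raise f) 0 = 0" "row (raise f) (Suc 0) = 0" "row (raise f) 2 = hs_deriv (row f 0)"
    and "row (lower f) 0 = hs_integral (row f 2)" "row (lower f) (Suc 0) = 0" "row (lower f) 2 = 0"
    and "row (degree_map f) 0 = - row f 0" "row (degree_map f) (Suc 0) = 0" "row (degree_map f) 2 = row f 2"
  using assms truncated_row[OF O_topD(1)] truncated_integral truncated_simps
  by (simp_all add: raise_def lower_def degree_map_def row_of_rows)

lemma sl2_closed [simp]:
  assumes "f \<in> O_top"
  shows "raise f \<in> O_top" "lower f \<in> O_top" "degree_map f \<in> O_top"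
proof -
  have top: "g top = hs_nth (row g 2) (3 ^ n - 1)" for g
    by (simp add: top_def)
  \<comment> \<open>These two coefficients become the top coefficients of \<open>raise f\<close> and
    \<open>degree_map f\<close>.\<close>
  have "f (bi_index 0 (3 ^ n)) = 0" "f (bi_index 2 (3 ^ n - 1)) = 0"
    using assms by (auto simp: O_carrier_bi_index O_top_def top_def)
  then show "raise f \<in> O_top" "lower f \<in> O_top" "degree_map f \<in> O_top"
    unfolding O_top_def mem_Collect_eq top
    using assms by (simp_all del: hs_nth_row) (simp_all add: raise_def lower_def degree_map_def)
qed

lemma sl2_linear:
  "raise (\<lambda>a. f a + g a) = (\<lambda>a. raise f a + raise g a)" "raise (\<lambda>a. c * f a) = (\<lambda>a. c * raise f a)"
  "lower (\<lambda>a. f a + g a) = (\<lambda>a. lower f a + lower g a)" "lower (\<lambda>a. c * f a) = (\<lambda>a. c * lower f a)"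
  "degree_map (\<lambda>a. f a + g a) = (\<lambda>a. degree_map f a + degree_map g a)"
  "degree_map (\<lambda>a. c * f a) = (\<lambda>a. c * degree_map f a)"
  by (rule ext; simp add: raise_def lower_def degree_map_def of_rows_def hs_nth_integral)+

lemma O_sum_closed: "f \<in> O_carrier \<Longrightarrow> g \<in> O_carrier \<Longrightarrow> (\<lambda>a. f a + g a) \<in> O_carrier"
  using O.M.a_closed by simp

lemma O_diff_closed: "f \<in> O_carrier \<Longrightarrow> g \<in> O_carrier \<Longrightarrow> (\<lambda>a. f a - g a) \<in> O_carrier"
  using O.M.minus_closed by (simp add: O_minus)

text \<open>Equality under \<open>ham\<close> sees row 0 through \<open>hs_deriv\<close>, which
  cancels the integral in \<open>lower\<close>. What remains are ring identities between the rows
  and their derivatives.\<close>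

lemma sl2_ham_derivation:
  shows "ham_derivation raise" "ham_derivation lower" "ham_derivation degree_map"
proof -
  have cl: "raise f \<in> O_carrier" "lower f \<in> O_carrier" "degree_map f \<in> O_carrier" for f
    by (simp_all add: raise_def lower_def degree_map_def)
  note [simp] = O_topD(1) ham_O_top ham_closed O_sum_closed row_ham ham_eq_iff_rows sl2_linear cl
  show "ham_derivation raise"
    unfolding ham_derivation_def by (simp add: algebra_simps)
  show "ham_derivation lower"
    unfolding ham_derivation_def by (simp add: algebra_simps)
  show "ham_derivation degree_map"
    unfolding ham_derivation_def by (simp add: algebra_simps)
qed

text \<open>These are the standard relations of sl_2 with e = \<open>raise\<close>, f =
  \<open>lower\<close> and h = \<open>degree_map\<close>: modulo 3 the factor -2 is 1, which gives
  the form that \<open>not_solvable_Out\<close> expects.\<close>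

lemma sl2_brackets:
  shows "bracket (Der class_ring H) (lift_operator raise) (lift_operator lower) = lift_operator degree_map"
    and "bracket (Der class_ring H) (lift_operator raise) (lift_operator degree_map) = lift_operator raise"
    and "bracket (Der class_ring H) (lift_operator degree_map) (lift_operator lower) = lift_operator lower"
proof -
  note [simp] = O_topD(1) O_diff_closed ham_eq_iff_rows
  have two: "- h - h = h" for h :: "'a hseries"
  proof -
    have "- h - h = - (2 * h)" by simp
    then show ?thesis by (simp only: two_hs_eq) simp
  qed
  show "bracket (Der class_ring H) (lift_operator raise) (lift_operator lower) = lift_operator degree_map"
    by (intro lift_operator_bracket sl2_ham_derivation) simp
  show "bracket (Der class_ring H) (lift_operator raise) (lift_operator degree_map) = lift_operator raise"
    by (intro lift_operator_bracket sl2_ham_derivation) (simp add: two)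
  show "bracket (Der class_ring H) (lift_operator degree_map) (lift_operator lower) = lift_operator lower"
    by (intro lift_operator_bracket sl2_ham_derivation) (simp add: two)
qed

text \<open>If \<open>raise\<close> were the bracket with some \<open>z\<close>, testing it on
  \<open>X\<close> and \<open>XY\<close>, which it kills, would make \<open>z\<close> constant. A
  constant brackets \<open>Y\<close> to zero, whereas \<open>raise\<close> maps \<open>Y\<close> to
  \<open>X2\<close>.\<close>

lemma raise_not_inner: "lift_operator raise \<notin> inner_derivations H"
proof
  assume "lift_operator raise \<in> inner_derivations H"
  then obtain z where z: "z \<in> O_top" "lift_operator raise = restrict (bracket H (ham z)) (carrier H)"
    by (auto simp: inner_derivations_def H_simps)
  have zc: "z \<in> O_carrier" using z(1) by (rule O_topD)
  have eq: "ham (raise f) = ham (ham z f)" if "f \<in> O_top" for f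
  proof -
    have "ham (raise f) = lift_operator raise (ham f)"
      using that by (simp add: lift_operator_ham sl2_ham_derivation)
    also have "\<dots> = ham (ham z f)"
      using that z by (simp add: H_simps H_bracket O_topD)
    finally show ?thesis .
  qed
  note [simp] = O_topD(1) ham_closed row_ham ham_eq_iff_rows quadratic_O_top zc
  \<comment> \<open>\<open>X\<close> gives the vanishing of derivatives, the second derivative in
    row 0. Substituted into the equation for \<open>XY\<close>, this leaves just the rows themselves
    and the first derivative of row 0.\<close>
  have "hs_deriv (hs_deriv (row z 0)) = 0" "hs_deriv (row z (Suc 0)) = 0" "hs_deriv (row z 2) = 0"
    using eq[of X] by simp_all
  moreover from this have "hs_deriv (row z 0) = 0" "row z (Suc 0) = 0" "row z 2 = 0"
    using eq[of XY] by simp_all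
  ultimately show False
    using eq[of Y] by simp
qed

lemma Out_H_not_solvable: "\<not> solvable_lie class_ring (Out class_ring H)"
  using sl2_brackets raise_not_inner
  by (intro H.not_solvable_Out[of "lift_operator raise" "lift_operator lower" "lift_operator degree_map"]
      lift_operator_derivation sl2_ham_derivation)

end

theorem theorem3p4:
  fixes n :: nat
    and H :: "('a::field, 'a dpoly \<Rightarrow> 'a dpoly) lie_algebra"
  assumes "CHAR('a) = 3"
    and "n \<ge> 1"
    and "H = hamiltonian_algebra 1 (\<lambda>i. if i = 1 then 1 else n)"
  shows "simple_lie_algebra class_ring H
    \<and> vectorspace.fin_dim class_ring H
    \<and> vectorspace.dim class_ring H = 3 ^ (n + 1) - 2
    \<and> \<not> solvable_lie class_ring (Out class_ring H)"
proof -
  interpret A: hamiltonian_char_3 n "TYPE('a)"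
    using assms(1,2) by unfold_locales
  have "H = A.H"
    using assms(3) A.H_eq by (simp only: A.heights_def)
  then show ?thesis
    using A.H_simple A.H_dim A.Out_H_not_solvable by simp
qed

end
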